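(* Let $G$ be a cyclic group of order $m\ge2$ with generator $g$, let $k$ be a field of characteristic different from $2$ containing a primitive root of unity $\mathfrak q$ of order $m^2$, put $q=\mathfrak q^m$, and let $0\le c\le m-1$. If there exists a non-trivial $2$-dimensional Hopf algebra within ${}_{k_{\Phi_c}[G]}^{k_{\Phi_c}[G]}\mathcal{YD}$, then the GCD of $c$ and $m$ is even. Assuming the GCD $(c,m)$ is even, a non-trivial Hopf algebra of dimension $2$ in ${}_{k_{\Phi_c}[G]}^{k_{\Phi_c}[G]}\mathcal{YD}$ is of the form $B_{\sigma,v}$, with $\sigma:k[G]\to k$ an algebra morphism and $v\in k[G]$, determined by $f,\lambda\in\{0,\dots,m-1\}$ satisfying $$\frac{\lambda f}{m}+\frac{cf^2}{m^2}-\frac12\in\mathbb Z$$ as follows: $\sigma(g^j)=q^{fj}$ for all $g^j\in G$, and $v=\sum_{j=0}^{m-1}\mathfrak q^{m\lambda j+cfj}\,1_j$.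
   Context: A quasi-bialgebra is $(H,\Delta,\varepsilon,\Phi)$ with $H$ a unital associative $k$-algebra, $\Phi\in H^{\otimes 3}$ invertible, $\Delta,\varepsilon$ algebra maps such that $(\mathrm{id}\otimes\Delta)\Delta(h)=\Phi(\Delta\otimes\mathrm{id})(\Delta(h))\Phi^{-1}$, $(\mathrm{id}\otimes\varepsilon)\Delta=\mathrm{id}=(\varepsilon\otimes\mathrm{id})\Delta$, $(\mathrm{id}\otimes\varepsilon\otimes\mathrm{id})(\Phi)=1\otimes1$, $(1\otimes\Phi)(\mathrm{id}\otimes\Delta\otimes\mathrm{id})(\Phi)(\Phi\otimes1)=(\mathrm{id}\otimes\mathrm{id}\otimes\Delta)(\Phi)(\Delta\otimes\mathrm{id}\otimes\mathrm{id})(\Phi)$; it is quasi-Hopf if there are an algebra anti-morphism $S$ and $\alpha,\beta\in H$ with $S(h_1)\alpha h_2=\varepsilon(h)\alpha$, $h_1\beta S(h_2)=\varepsilon(h)\beta$, $X^1\beta S(X^2)\alpha X^3=1$, $S(x^1)\alpha x^2\beta S(x^3)=1$. Notation: $\Delta(h)=h_1\otimes h_2$, $\Phi=X^1\otimes X^2\otimes X^3=Y^1\otimes Y^2\otimes Y^3$, $\Phi^{-1}=x^1\otimes x^2\otimes x^3$ (summation understood; different letters are independent copies). A left Yetter-Drinfeld module over $H$ is a left $H$-module $M$ with a map $M\to H\otimes M$, $m\mapsto m_{[-1]}\otimes m_{[0]}$, such that $\varepsilon(m_{[-1]})m_{[0]}=m$, $X^1m_{[-1]}\otimes(X^2\cdot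 m_{[0]})_{[-1]}X^3\otimes(X^2\cdot m_{[0]})_{[0]}=X^1((Y^1\cdot m)_{[-1]})_1Y^2\otimes X^2((Y^1\cdot m)_{[-1]})_2Y^3\otimes X^3\cdot(Y^1\cdot m)_{[0]}$, and $h_1m_{[-1]}\otimes h_2\cdot m_{[0]}=(h_1\cdot m)_{[-1]}h_2\otimes(h_1\cdot m)_{[0]}$. ${}_H^H\mathcal{YD}$ is braided monoidal with diagonal action, coaction $m\otimes n\mapsto X^1(x^1Y^1\cdot m)_{[-1]}x^2(Y^2\cdot n)_{[-1]}Y^3\otimes X^2\cdot(x^1Y^1\cdot m)_{[0]}\otimes X^3x^3\cdot(Y^2\cdot n)_{[0]}$, associativity constraint $(m\otimes n)\otimes p\mapsto X^1\cdot m\otimes(X^2\cdot n\otimes X^3\cdot p)$, trivial unit object $k$, braiding $m\otimes n\mapsto m_{[-1]}\cdot n\otimes m_{[0]}$. Hopf algebras in ${}_H^H\mathcal{YD}$ are Hopf algebras in this braided category, considered up to isomorphism. "Non-trivial" ($2$-dimensional) means not isomorphic to the group Hopf algebra $k[C_2]$ with trivial action (via $\varepsilon$) and coaction (via $1_H$). $1_j=\frac1m\sum_{s=0}^{m-1}q^{-js}g^s$, $0\le j\le m-1$, are orthogonal idempotents of $k[G]$. $k_{\Phi_c}[G]$ is the group Hopf algebra $k[G]$ viewed as a quasi-Hopf algebra with reassociator $\Phi_c=\sum_{i,j,l=0}^{m-1}q^{ci\lfloor\frac{j+l}{m}\rfloor}1_i\otimes1_j\otimes1_l$ (usual antipode,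 $\alpha=1$, and $\beta=\sum_{i}q^{-ci\lfloor\frac{(m-i)'+i}{m}\rfloor}1_i$ where $(m-i)'$ is the residue of $-i$ modulo $m$ in $\{0,\dots,m-1\}$). $B_{\sigma,v}$ is the $2$-dimensional space with basis $\{1,n\}$, action $h\cdot1=\varepsilon(h)1$, $h\cdot n=\sigma(h)n$, coaction $1\mapsto1\otimes1$, $n\mapsto v\otimes n$, unit $1$, $n^2=0$, comultiplication $1\mapsto1\otimes1$, $n\mapsto n\otimes1+1\otimes n$, counit $1\mapsto1$, $n\mapsto0$, antipode $1\mapsto1$, $n\mapsto-n$. *)

theory Defs
  imports
    "HOL-Analysis.Cartesian_Space"
    "HOL-Algebra.Generated_Groups"
    "HOL-Library.Numeral_Type"
begin

text \<open>
  Finite-dimensional vector spaces over the field \<^typ>\<open>'k\<close> are taken in coordinates: a space with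
  a basis indexed by the finite type \<^typ>\<open>'i\<close> is \<^typ>\<open>'k ^ 'i\<close>, of dimension \<^term>\<open>CARD('i)\<close>, and
  the tensor product of \<^typ>\<open>'k ^ 'i\<close> and \<^typ>\<open>'k ^ 'j\<close> is \<^typ>\<open>'k ^ ('i \<times> 'j)\<close>.
  The ground field is both \<^typ>\<open>'k\<close> and, when a vector space type is needed, \<^typ>\<open>'k ^ 1\<close>;
  the unit constraints of the tensor product are suppressed.
\<close>

section \<open>Tensor products and Sweedler sums\<close>

abbreviation linear_map :: "('k::field ^ 'i \<Rightarrow> 'k ^ 'j) \<Rightarrow> bool" where
  "linear_map \<equiv> Vector_Spaces.linear (*s) (*s)"

abbreviation linear_form :: "('k::field ^ 'i \<Rightarrow> 'k) \<Rightarrow> bool" where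
  "linear_form \<equiv> Vector_Spaces.linear (*s) (*)"

definition bilinear_map :: "('k::field ^ 'i \<Rightarrow> 'k ^ 'j \<Rightarrow> 'k ^ 'n) \<Rightarrow> bool" where
  "bilinear_map b \<longleftrightarrow> (\<forall>x. linear_map (b x)) \<and> (\<forall>y. linear_map (\<lambda>x. b x y))"

definition tens :: "'k::field ^ 'i \<Rightarrow> 'k ^ 'j \<Rightarrow> 'k ^ ('i \<times> 'j)"  (infixr "\<boxtimes>" 72) where
  "x \<boxtimes> y = (\<chi> p. x $ fst p * y $ snd p)"

text \<open>
  If \<open>t\<close> is written in Sweedler style as \<open>t\<^sub>1 \<otimes> t\<^sub>2\<close> (summation understood) and \<open>b\<close> is bilinear,
  then \<open>sweedler2 t b\<close> is \<open>b(t\<^sub>1, t\<^sub>2)\<close>, i.e. the linear map induced by \<open>b\<close> applied to \<open>t\<close>.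
  Likewise for \<open>sweedler3\<close>.
\<close>

definition sweedler2 ::
  "'k::field ^ ('i \<times> 'j) \<Rightarrow> ('k ^ 'i \<Rightarrow> 'k ^ 'j \<Rightarrow> 'k ^ 'n) \<Rightarrow> 'k ^ 'n" where
  "sweedler2 t b = (\<Sum>i\<in>UNIV. \<Sum>j\<in>UNIV. t $ (i, j) *s b (axis i 1) (axis j 1))"

definition sweedler3 ::
  "'k::field ^ ('i \<times> 'j \<times> 'l) \<Rightarrow> ('k ^ 'i \<Rightarrow> 'k ^ 'j \<Rightarrow> 'k ^ 'l \<Rightarrow> 'k ^ 'n) \<Rightarrow> 'k ^ 'n" where
  "sweedler3 t b = (\<Sum>i\<in>UNIV. \<Sum>j\<in>UNIV. \<Sum>l\<in>UNIV.
      t $ (i, j, l) *s b (axis i 1) (axis j 1) (axis l 1))"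

definition tens_map ::
  "('k::field ^ 'i \<Rightarrow> 'k ^ 'r) \<Rightarrow> ('k ^ 'j \<Rightarrow> 'k ^ 's) \<Rightarrow> 'k ^ ('i \<times> 'j) \<Rightarrow> 'k ^ ('r \<times> 's)" where
  "tens_map f g t = sweedler2 t (\<lambda>x y. f x \<boxtimes> g y)"


section \<open>Quasi-bialgebras and quasi-Hopf algebras\<close>

record ('k, 'h::finite) quasi_hopf_data =
  hmul :: "'k ^ 'h \<Rightarrow> 'k ^ 'h \<Rightarrow> 'k ^ 'h"
  hone :: "'k ^ 'h"
  hcomul :: "'k ^ 'h \<Rightarrow> 'k ^ ('h \<times> 'h)"
  hcounit :: "'k ^ 'h \<Rightarrow> 'k"
  reassoc :: "'k ^ ('h \<times> 'h \<times> 'h)"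
  hantipode :: "'k ^ 'h \<Rightarrow> 'k ^ 'h"
  halpha :: "'k ^ 'h"
  hbeta :: "'k ^ 'h"

definition algebra :: "('k::field, 'h::finite) quasi_hopf_data \<Rightarrow> bool" where
  "algebra H \<longleftrightarrow>
     bilinear_map (hmul H) \<and>
     (\<forall>a b c. hmul H (hmul H a b) c = hmul H a (hmul H b c)) \<and>
     (\<forall>a. hmul H (hone H) a = a \<and> hmul H a (hone H) = a)"

definition mul2 :: "('k::field, 'h::finite) quasi_hopf_data \<Rightarrow>
    'k ^ ('h \<times> 'h) \<Rightarrow> 'k ^ ('h \<times> 'h) \<Rightarrow> 'k ^ ('h \<times> 'h)" where
  "mul2 H s t = sweedler2 s (\<lambda>a b. sweedler2 t (\<lambda>a' b'. hmul H a a' \<boxtimes> hmul H b b'))"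

definition mul3 :: "('k::field, 'h::finite) quasi_hopf_data \<Rightarrow>
    'k ^ ('h \<times> 'h \<times> 'h) \<Rightarrow> 'k ^ ('h \<times> 'h \<times> 'h) \<Rightarrow> 'k ^ ('h \<times> 'h \<times> 'h)" where
  "mul3 H s t = sweedler3 s (\<lambda>a b c. sweedler3 t (\<lambda>a' b' c'.
      hmul H a a' \<boxtimes> hmul H b b' \<boxtimes> hmul H c c'))"

definition one3 :: "('k::field, 'h::finite) quasi_hopf_data \<Rightarrow> 'k ^ ('h \<times> 'h \<times> 'h)" where
  "one3 H = hone H \<boxtimes> hone H \<boxtimes> hone H"

definition reassoc_inv :: "('k::field, 'h::finite) quasi_hopf_data \<Rightarrow> 'k ^ ('h \<times> 'h \<times> 'h)" where
  "reassoc_inv H =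
     (THE t. mul3 H (reassoc H) t = one3 H \<and> mul3 H t (reassoc H) = one3 H)"

definition algebra_hom_to_field ::
  "('k::field, 'h::finite) quasi_hopf_data \<Rightarrow> ('k ^ 'h \<Rightarrow> 'k) \<Rightarrow> bool" where
  "algebra_hom_to_field H \<sigma> \<longleftrightarrow>
     linear_form \<sigma> \<and> \<sigma> (hone H) = 1 \<and> (\<forall>a b. \<sigma> (hmul H a b) = \<sigma> a * \<sigma> b)"

definition quasi_bialgebra :: "('k::field, 'h::finite) quasi_hopf_data \<Rightarrow> bool" where
  "quasi_bialgebra H \<longleftrightarrow>
     algebra H \<and>
     (\<exists>t. mul3 H (reassoc H) t = one3 H \<and> mul3 H t (reassoc H) = one3 H) \<and>
     linear_map (hcomul H) \<and> hcomul H (hone H) = hone H \<boxtimes> hone H \<and>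
     (\<forall>a b. hcomul H (hmul H a b) = mul2 H (hcomul H a) (hcomul H b)) \<and>
     algebra_hom_to_field H (hcounit H) \<and>
     (\<forall>h. sweedler2 (hcomul H h) (\<lambda>h\<^sub>1 h\<^sub>2. h\<^sub>1 \<boxtimes> hcomul H h\<^sub>2) =
          mul3 H (mul3 H (reassoc H)
              (sweedler2 (hcomul H h) (\<lambda>h\<^sub>1 h\<^sub>2. sweedler2 (hcomul H h\<^sub>1) (\<lambda>a b. a \<boxtimes> b \<boxtimes> h\<^sub>2))))
            (reassoc_inv H)) \<and>
     (\<forall>h. sweedler2 (hcomul H h) (\<lambda>h\<^sub>1 h\<^sub>2. hcounit H h\<^sub>2 *s h\<^sub>1) = h \<and>
          sweedler2 (hcomul H h) (\<lambda>h\<^sub>1 h\<^sub>2. hcounit H h\<^sub>1 *s h\<^sub>2) = h) \<and>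
     sweedler3 (reassoc H) (\<lambda>X\<^sub>1 X\<^sub>2 X\<^sub>3. hcounit H X\<^sub>2 *s (X\<^sub>1 \<boxtimes> X\<^sub>3)) = hone H \<boxtimes> hone H \<and>
     sweedler3 (reassoc H) (\<lambda>X\<^sub>1 X\<^sub>2 X\<^sub>3. sweedler3 (reassoc H) (\<lambda>Y\<^sub>1 Y\<^sub>2 Y\<^sub>3.
       sweedler3 (reassoc H) (\<lambda>Z\<^sub>1 Z\<^sub>2 Z\<^sub>3. sweedler2 (hcomul H Y\<^sub>2) (\<lambda>a b.
         hmul H Y\<^sub>1 Z\<^sub>1 \<boxtimes> hmul H (hmul H X\<^sub>1 a) Z\<^sub>2 \<boxtimes> hmul H (hmul H X\<^sub>2 b) Z\<^sub>3
           \<boxtimes> hmul H X\<^sub>3 Y\<^sub>3)))) =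
     sweedler3 (reassoc H) (\<lambda>X\<^sub>1 X\<^sub>2 X\<^sub>3. sweedler3 (reassoc H) (\<lambda>Y\<^sub>1 Y\<^sub>2 Y\<^sub>3.
       sweedler2 (hcomul H X\<^sub>3) (\<lambda>a b. sweedler2 (hcomul H Y\<^sub>1) (\<lambda>c d.
         hmul H X\<^sub>1 c \<boxtimes> hmul H X\<^sub>2 d \<boxtimes> hmul H a Y\<^sub>2 \<boxtimes> hmul H b Y\<^sub>3))))"

definition quasi_hopf_algebra :: "('k::field, 'h::finite) quasi_hopf_data \<Rightarrow> bool" where
  "quasi_hopf_algebra H \<longleftrightarrow>
     quasi_bialgebra H \<and>
     linear_map (hantipode H) \<and> hantipode H (hone H) = hone H \<and>
     (\<forall>a b. hantipode H (hmul H a b) = hmul H (hantipode H b) (hantipode H a)) \<and>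
     (\<forall>h. sweedler2 (hcomul H h) (\<lambda>h\<^sub>1 h\<^sub>2. hmul H (hmul H (hantipode H h\<^sub>1) (halpha H)) h\<^sub>2) =
            hcounit H h *s halpha H) \<and>
     (\<forall>h. sweedler2 (hcomul H h) (\<lambda>h\<^sub>1 h\<^sub>2. hmul H (hmul H h\<^sub>1 (hbeta H)) (hantipode H h\<^sub>2)) =
            hcounit H h *s hbeta H) \<and>
     sweedler3 (reassoc H) (\<lambda>X\<^sub>1 X\<^sub>2 X\<^sub>3.
       hmul H (hmul H (hmul H (hmul H X\<^sub>1 (hbeta H)) (hantipode H X\<^sub>2)) (halpha H)) X\<^sub>3) = hone H \<and>
     sweedler3 (reassoc_inv H) (\<lambda>x\<^sub>1 x\<^sub>2 x\<^sub>3.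
       hmul H (hmul H (hmul H (hmul H (hantipode H x\<^sub>1) (halpha H)) x\<^sub>2) (hbeta H)) (hantipode H x\<^sub>3))
       = hone H"


section \<open>The braided monoidal category of left Yetter-Drinfeld modules\<close>

text \<open>
  The notions below are defined from the data of \<open>H\<close> alone; that \<open>H\<close> is a quasi-Hopf algebra
  is deliberately not built into them as a hypothesis.
\<close>

record ('k, 'h::finite, 'm::finite) yd =
  act :: "'k ^ 'h \<Rightarrow> 'k ^ 'm \<Rightarrow> 'k ^ 'm"
  coact :: "'k ^ 'm \<Rightarrow> 'k ^ ('h \<times> 'm)"

definition yd_module ::
  "('k::field, 'h::finite) quasi_hopf_data \<Rightarrow> ('k, 'h, 'm::finite, 'z) yd_scheme \<Rightarrow> bool" where
  "yd_module H M \<longleftrightarrow>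
     bilinear_map (act M) \<and>
     (\<forall>a b m. act M (hmul H a b) m = act M a (act M b m)) \<and>
     (\<forall>m. act M (hone H) m = m) \<and>
     linear_map (coact M) \<and>
     (\<forall>m. sweedler2 (coact M m) (\<lambda>u n. hcounit H u *s n) = m) \<and>
     (\<forall>m. sweedler3 (reassoc H) (\<lambda>X\<^sub>1 X\<^sub>2 X\<^sub>3. sweedler2 (coact M m) (\<lambda>u n.
            sweedler2 (coact M (act M X\<^sub>2 n)) (\<lambda>w p.
              hmul H X\<^sub>1 u \<boxtimes> hmul H w X\<^sub>3 \<boxtimes> p))) =
          sweedler3 (reassoc H) (\<lambda>X\<^sub>1 X\<^sub>2 X\<^sub>3. sweedler3 (reassoc H) (\<lambda>Y\<^sub>1 Y\<^sub>2 Y\<^sub>3.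
            sweedler2 (coact M (act M Y\<^sub>1 m)) (\<lambda>u n. sweedler2 (hcomul H u) (\<lambda>u\<^sub>1 u\<^sub>2.
              hmul H (hmul H X\<^sub>1 u\<^sub>1) Y\<^sub>2 \<boxtimes> hmul H (hmul H X\<^sub>2 u\<^sub>2) Y\<^sub>3 \<boxtimes> act M X\<^sub>3 n))))) \<and>
     (\<forall>h m. sweedler2 (hcomul H h) (\<lambda>h\<^sub>1 h\<^sub>2. sweedler2 (coact M m) (\<lambda>u n.
              hmul H h\<^sub>1 u \<boxtimes> act M h\<^sub>2 n)) =
            sweedler2 (hcomul H h) (\<lambda>h\<^sub>1 h\<^sub>2. sweedler2 (coact M (act M h\<^sub>1 m)) (\<lambda>u n.
              hmul H u h\<^sub>2 \<boxtimes> n)))"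

definition yd_hom :: "('k::field, 'h::finite, 'm::finite, 'y) yd_scheme \<Rightarrow>
    ('k, 'h, 'n::finite, 'z) yd_scheme \<Rightarrow> ('k ^ 'm \<Rightarrow> 'k ^ 'n) \<Rightarrow> bool" where
  "yd_hom M N f \<longleftrightarrow>
     linear_map f \<and>
     (\<forall>h x. f (act M h x) = act N h (f x)) \<and>
     (\<forall>x. coact N (f x) = sweedler2 (coact M x) (\<lambda>u y. u \<boxtimes> f y))"

definition yd_tensor :: "('k::field, 'h::finite) quasi_hopf_data \<Rightarrow>
    ('k, 'h, 'm::finite, 'y) yd_scheme \<Rightarrow> ('k, 'h, 'n::finite, 'z) yd_scheme \<Rightarrow>
    ('k, 'h, 'm \<times> 'n) yd" where
  "yd_tensor H M N = \<lparr>
     act = (\<lambda>h t. sweedler2 (hcomul H h) (\<lambda>h\<^sub>1 h\<^sub>2. sweedler2 t (\<lambda>m n. act M h\<^sub>1 m \<boxtimes> act N h\<^sub>2 n))),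
     coact = (\<lambda>t. sweedler2 t (\<lambda>m n.
       sweedler3 (reassoc H) (\<lambda>X\<^sub>1 X\<^sub>2 X\<^sub>3. sweedler3 (reassoc_inv H) (\<lambda>x\<^sub>1 x\<^sub>2 x\<^sub>3.
       sweedler3 (reassoc H) (\<lambda>Y\<^sub>1 Y\<^sub>2 Y\<^sub>3.
         sweedler2 (coact M (act M (hmul H x\<^sub>1 Y\<^sub>1) m)) (\<lambda>u m'.
         sweedler2 (coact N (act N Y\<^sub>2 n)) (\<lambda>w n'.
           hmul H (hmul H (hmul H (hmul H X\<^sub>1 u) x\<^sub>2) w) Y\<^sub>3 \<boxtimes>
             act M X\<^sub>2 m' \<boxtimes> act N (hmul H X\<^sub>3 x\<^sub>3) n'))))))) \<rparr>"

definition yd_unit :: "('k::field, 'h::finite) quasi_hopf_data \<Rightarrow> ('k, 'h, 1) yd" where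
  "yd_unit H = \<lparr> act = (\<lambda>h x. hcounit H h *s x), coact = (\<lambda>x. hone H \<boxtimes> x) \<rparr>"

definition yd_assoc :: "('k::field, 'h::finite) quasi_hopf_data \<Rightarrow>
    ('k, 'h, 'm::finite, 'x) yd_scheme \<Rightarrow> ('k, 'h, 'n::finite, 'y) yd_scheme \<Rightarrow>
    ('k, 'h, 'p::finite, 'z) yd_scheme \<Rightarrow> 'k ^ (('m \<times> 'n) \<times> 'p) \<Rightarrow> 'k ^ ('m \<times> 'n \<times> 'p)" where
  "yd_assoc H M N P t = sweedler2 t (\<lambda>s p. sweedler2 s (\<lambda>m n.
     sweedler3 (reassoc H) (\<lambda>X\<^sub>1 X\<^sub>2 X\<^sub>3. act M X\<^sub>1 m \<boxtimes> act N X\<^sub>2 n \<boxtimes> act P X\<^sub>3 p)))"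

definition yd_assoc_inv :: "('k::field, 'h::finite) quasi_hopf_data \<Rightarrow>
    ('k, 'h, 'm::finite, 'x) yd_scheme \<Rightarrow> ('k, 'h, 'n::finite, 'y) yd_scheme \<Rightarrow>
    ('k, 'h, 'p::finite, 'z) yd_scheme \<Rightarrow> 'k ^ ('m \<times> 'n \<times> 'p) \<Rightarrow> 'k ^ (('m \<times> 'n) \<times> 'p)" where
  "yd_assoc_inv H M N P t = sweedler3 t (\<lambda>m n p.
     sweedler3 (reassoc_inv H) (\<lambda>x\<^sub>1 x\<^sub>2 x\<^sub>3. (act M x\<^sub>1 m \<boxtimes> act N x\<^sub>2 n) \<boxtimes> act P x\<^sub>3 p))"

definition yd_braiding :: "('k::field, 'h::finite, 'm::finite, 'y) yd_scheme \<Rightarrow>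
    ('k, 'h, 'n::finite, 'z) yd_scheme \<Rightarrow> 'k ^ ('m \<times> 'n) \<Rightarrow> 'k ^ ('n \<times> 'm)" where
  "yd_braiding M N t = sweedler2 t (\<lambda>m n. sweedler2 (coact M m) (\<lambda>u m'. act N u n \<boxtimes> m'))"

text \<open>
  The middle-four interchange \<open>(M \<otimes> N) \<otimes> (P \<otimes> Q) \<rightarrow> (M \<otimes> P) \<otimes> (N \<otimes> Q)\<close>: braid \<open>N\<close> past \<open>P\<close>,
  rebracketing by the associativity constraint before and after.
\<close>

definition yd_interchange :: "('k::field, 'h::finite) quasi_hopf_data \<Rightarrow>
    ('k, 'h, 'm::finite, 'w) yd_scheme \<Rightarrow> ('k, 'h, 'n::finite, 'x) yd_scheme \<Rightarrow>
    ('k, 'h, 'p::finite, 'y) yd_scheme \<Rightarrow> ('k, 'h, 'q::finite, 'z) yd_scheme \<Rightarrow>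
    'k ^ (('m \<times> 'n) \<times> ('p \<times> 'q)) \<Rightarrow> 'k ^ (('m \<times> 'p) \<times> ('n \<times> 'q))" where
  "yd_interchange H M N P Q =
     yd_assoc_inv H M P (yd_tensor H N Q) \<circ>
     tens_map id (yd_assoc H P N Q) \<circ>
     tens_map id (tens_map (yd_braiding N P) id) \<circ>
     tens_map id (yd_assoc_inv H N P Q) \<circ>
     yd_assoc H M N (yd_tensor H P Q)"


section \<open>Hopf algebras in the category of Yetter-Drinfeld modules\<close>

record ('k, 'h::finite, 'm::finite) yd_hopf = "('k, 'h, 'm) yd" +
  mul :: "'k ^ ('m \<times> 'm) \<Rightarrow> 'k ^ 'm"
  uni :: "'k ^ 'm"
  comul :: "'k ^ 'm \<Rightarrow> 'k ^ ('m \<times> 'm)"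
  coun :: "'k ^ 'm \<Rightarrow> 'k"
  antip :: "'k ^ 'm \<Rightarrow> 'k ^ 'm"

definition yd_hopf_algebra ::
  "('k::field, 'h::finite) quasi_hopf_data \<Rightarrow> ('k, 'h, 'm::finite) yd_hopf \<Rightarrow> bool" where
  "yd_hopf_algebra H B \<longleftrightarrow>
     yd_module H B \<and>
     \<comment> \<open>the structure maps are morphisms\<close>
     yd_hom (yd_tensor H B B) B (mul B) \<and>
     yd_hom (yd_unit H) B (\<lambda>c. c $ 1 *s uni B) \<and>
     yd_hom B (yd_tensor H B B) (comul B) \<and>
     yd_hom B (yd_unit H) (\<lambda>b. vec (coun B b)) \<and>
     yd_hom B B (antip B) \<and>
     \<comment> \<open>algebra\<close>
     mul B \<circ> tens_map (mul B) id = mul B \<circ> tens_map id (mul B) \<circ> yd_assoc H B B B \<and>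
     (\<forall>b. mul B (uni B \<boxtimes> b) = b \<and> mul B (b \<boxtimes> uni B) = b) \<and>
     \<comment> \<open>coalgebra\<close>
     yd_assoc H B B B \<circ> tens_map (comul B) id \<circ> comul B = tens_map id (comul B) \<circ> comul B \<and>
     (\<forall>b. sweedler2 (comul B b) (\<lambda>b\<^sub>1 b\<^sub>2. coun B b\<^sub>1 *s b\<^sub>2) = b \<and>
          sweedler2 (comul B b) (\<lambda>b\<^sub>1 b\<^sub>2. coun B b\<^sub>2 *s b\<^sub>1) = b) \<and>
     \<comment> \<open>comultiplication and counit are algebra morphisms\<close>
     comul B \<circ> mul B =
       tens_map (mul B) (mul B) \<circ> yd_interchange H B B B B \<circ> tens_map (comul B) (comul B) \<and>
     comul B (uni B) = uni B \<boxtimes> uni B \<and>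
     (\<forall>a b. coun B (mul B (a \<boxtimes> b)) = coun B a * coun B b) \<and>
     coun B (uni B) = 1 \<and>
     \<comment> \<open>antipode\<close>
     (\<forall>b. mul B (tens_map (antip B) id (comul B b)) = coun B b *s uni B \<and>
          mul B (tens_map id (antip B) (comul B b)) = coun B b *s uni B)"

definition yd_hopf_isomorphic :: "('k::field, 'h::finite, 'm::finite) yd_hopf \<Rightarrow>
    ('k, 'h, 'n::finite) yd_hopf \<Rightarrow> bool" where
  "yd_hopf_isomorphic A B \<longleftrightarrow>
     (\<exists>f. bij f \<and> yd_hom A B f \<and>
        (\<forall>t. f (mul A t) = mul B (tens_map f f t)) \<and>
        f (uni A) = uni B \<and>
        (\<forall>a. comul B (f a) = tens_map f f (comul A a)) \<and>
        (\<forall>a. coun B (f a) = coun A a) \<and>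
        (\<forall>a. f (antip A a) = antip B (f a)))"


section \<open>Group Hopf algebras and the quasi-Hopf algebras of a cyclic group\<close>

text \<open>
  The group algebra of a group with carrier \<^term>\<open>UNIV :: 'g set\<close> is \<^typ>\<open>'k ^ 'g\<close>; the group
  element \<open>a\<close> is the basis vector \<^term>\<open>axis a 1\<close>.
\<close>

definition ga_mul :: "'g::finite monoid \<Rightarrow> 'k::field ^ 'g \<Rightarrow> 'k ^ 'g \<Rightarrow> 'k ^ 'g" where
  "ga_mul G x y = (\<Sum>a\<in>UNIV. \<Sum>b\<in>UNIV. (x $ a * y $ b) *s axis (a \<otimes>\<^bsub>G\<^esub> b) 1)"

definition ga_comul :: "'k::field ^ 'g::finite \<Rightarrow> 'k ^ ('g \<times> 'g)" where
  "ga_comul x = (\<Sum>a\<in>UNIV. x $ a *s (axis a 1 \<boxtimes> axis a 1))"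

definition ga_counit :: "'k::field ^ 'g::finite \<Rightarrow> 'k" where
  "ga_counit x = (\<Sum>a\<in>UNIV. x $ a)"

definition ga_antipode :: "'g::finite monoid \<Rightarrow> 'k::field ^ 'g \<Rightarrow> 'k ^ 'g" where
  "ga_antipode G x = (\<Sum>a\<in>UNIV. x $ a *s axis (inv\<^bsub>G\<^esub> a) 1)"

text \<open>
  \<open>idem G g q j\<close> is the idempotent \<open>1\<^sub>j\<close>. In \<open>kPhi\<close>, \<open>(m - i) mod m\<close> is the residue of \<open>-i\<close>
  modulo \<open>m\<close>, as \<open>i < m\<close>.
\<close>

definition idem :: "'g::finite monoid \<Rightarrow> 'g \<Rightarrow> 'k::field \<Rightarrow> nat \<Rightarrow> 'k ^ 'g" where
  "idem G g q j = (\<Sum>s<order G. (inverse q ^ (j * s) / of_nat (order G)) *s axis (g [^]\<^bsub>G\<^esub> s) 1)"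

definition kPhi :: "'g::finite monoid \<Rightarrow> 'g \<Rightarrow> 'k::field \<Rightarrow> nat \<Rightarrow> ('k, 'g) quasi_hopf_data" where
  "kPhi G g q c = (let m = order G in \<lparr>
     hmul = ga_mul G,
     hone = axis \<one>\<^bsub>G\<^esub> 1,
     hcomul = ga_comul,
     hcounit = ga_counit,
     reassoc = (\<Sum>i<m. \<Sum>j<m. \<Sum>l<m.
        q ^ (c * i * ((j + l) div m)) *s (idem G g q i \<boxtimes> idem G g q j \<boxtimes> idem G g q l)),
     hantipode = ga_antipode G,
     halpha = axis \<one>\<^bsub>G\<^esub> 1,
     hbeta = (\<Sum>i<m. inverse q ^ (c * i * (((m - i) mod m + i) div m)) *s idem G g q i) \<rparr>)"

text \<open>The group of order two is the additive group of the type \<^typ>\<open>2\<close>.\<close>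

definition C2 :: "2 monoid" where
  "C2 = \<lparr> carrier = UNIV, mult = (+), one = 0 \<rparr>"

definition kC2 :: "('k::field, 'h::finite) quasi_hopf_data \<Rightarrow> ('k, 'h, 2) yd_hopf" where
  "kC2 H = \<lparr>
     act = (\<lambda>h x. hcounit H h *s x),
     coact = (\<lambda>x. hone H \<boxtimes> x),
     mul = (\<lambda>t. sweedler2 t (ga_mul C2)),
     uni = axis \<one>\<^bsub>C2\<^esub> 1,
     comul = ga_comul,
     coun = ga_counit,
     antip = ga_antipode C2 \<rparr>"

definition nontrivial_yd_hopf_algebra ::
  "('k::field, 'h::finite) quasi_hopf_data \<Rightarrow> ('k, 'h, 'm::finite) yd_hopf \<Rightarrow> bool" where
  "nontrivial_yd_hopf_algebra H B \<longleftrightarrow>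
     yd_hopf_algebra H B \<and> \<not> yd_hopf_isomorphic B (kC2 H)"


section \<open>The Yetter-Drinfeld Hopf algebras \<open>B\<^sub>\<sigma>\<^sub>,\<^sub>v\<close>\<close>

text \<open>The basis \<open>{1, n}\<close> is indexed by the type \<^typ>\<open>2\<close>, with \<open>1\<close> at index 0 and \<open>n\<close> at index 1.\<close>

abbreviation B_one :: "'k::field ^ 2" where "B_one \<equiv> axis 0 1"

abbreviation B_n :: "'k::field ^ 2" where "B_n \<equiv> axis 1 1"

definition Bsv :: "('k::field, 'h::finite) quasi_hopf_data \<Rightarrow> ('k ^ 'h \<Rightarrow> 'k) \<Rightarrow> 'k ^ 'h \<Rightarrow>
    ('k, 'h, 2) yd_hopf" where
  "Bsv H \<sigma> v = \<lparr>
     act = (\<lambda>h x. (hcounit H h * x $ 0) *s B_one + (\<sigma> h * x $ 1) *s B_n),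
     coact = (\<lambda>x. x $ 0 *s (hone H \<boxtimes> B_one) + x $ 1 *s (v \<boxtimes> B_n)),
     mul = (\<lambda>t. t $ (0, 0) *s B_one + (t $ (0, 1) + t $ (1, 0)) *s B_n),
     uni = B_one,
     comul = (\<lambda>x. x $ 0 *s (B_one \<boxtimes> B_one) + x $ 1 *s (B_n \<boxtimes> B_one + B_one \<boxtimes> B_n)),
     coun = (\<lambda>x. x $ 0),
     antip = (\<lambda>x. x $ 0 *s B_one - x $ 1 *s B_n) \<rparr>"

definition primitive_root_of_unity :: "nat \<Rightarrow> 'k::field \<Rightarrow> bool" where
  "primitive_root_of_unity n z \<longleftrightarrow> n > 0 \<and> z ^ n = 1 \<and> (\<forall>d. 0 < d \<and> d < n \<longrightarrow> z ^ d \<noteq> 1)"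

end

theory Submission
  imports Defs "HOL-Algebra.Multiplicative_Group" "HOL-Computational_Algebra.Polynomial"
begin

text \<open>
  The algebra \<open>k[G]\<close> is a product of fields: its characters \<open>ch j\<close>, sending \<open>g\<close> to \<open>q\<^sup>j\<close>, are dual to
  the idempotents \<open>1\<^sub>j\<close>, and an element of a tensor power of \<open>k[G]\<close> is determined by its values on
  tuples of characters (\<open>ch_separate_tens\<close>). On a triple of characters the reassociator
  is a power of \<open>q\<close>, equal to \<open>1\<close> as soon as one of the characters is trivial.

  Let \<open>B\<close> be two-dimensional and let \<open>n\<close> span the kernel of the counit. Since the unit and the counit
  are morphisms, \<open>B = k 1 \<oplus> k n\<close> as a Yetter-Drinfeld module, with \<open>1\<close> spanning a trivial submodule.
  So \<open>h \<cdot> n = \<sigma>(h) n\<close> with \<open>\<sigma>(g) = q\<^sup>f\<close>, and \<open>n\<close> has coaction \<open>v \<otimes> n\<close>. Evaluated at characters, the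
  Yetter-Drinfeld condition says that the coordinates of \<open>v\<close> satisfy
  \<open>V i V l = q\<^bsup>c f \<lfloor>(i+l)/m\<rfloor>\<^esup> V (i + l)\<close> for residues \<open>i\<close> and \<open>l\<close>, with indices read modulo \<open>m\<close>
  (\<open>V_mult\<close>). Hence \<open>V j\<close> is the \<open>j\<close>-th power of \<open>V 1\<close>, and \<open>V 1\<close> is an \<open>m\<close>-th root of \<open>q\<^bsup>c f\<^esup>\<close>.

  The remaining structure is \<open>n\<^sup>2 = lam n\<close> and \<open>\<Delta>(n) = n \<otimes> 1 + 1 \<otimes> n + mu n \<otimes> n\<close>. On the basis vectors
  the braided interchange is the flip up to explicit scalars (\<open>yd_interchange_weight\<close>), so
  the coefficient of \<open>n \<otimes> n\<close> in \<open>\<Delta>(n\<^sup>2) = \<Delta>(n) \<Delta>(n)\<close> can be computed (\<open>compat_nn\<close>), and there are two cases.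

  If \<open>lam\<close> is non-zero, equivariance of the product makes the action and the coaction trivial, so
  \<open>B\<close> is an ordinary Hopf algebra; the coefficient and the antipode give \<open>lam mu = -2\<close>, and
  \<open>1 + mu n\<close> is a group-like element of order two. This is the trivial case \<open>k[C\<^sub>2]\<close>
  (\<open>group_algebra_case\<close>).

  If \<open>lam = 0\<close>, the coefficient gives \<open>\<sigma>(v) = -1\<close>, which excludes trivial action and hence forces
  \<open>mu = 0\<close>; so \<open>B\<close> is \<open>B\<^sub>\<sigma>\<^sub>,\<^sub>v\<close> (\<open>Bsv_case\<close>). The equation \<open>\<sigma>(v) = V f = -1\<close> is the integrality condition
  (\<open>parameters\<close>), and a descent on the power of \<open>2\<close> dividing \<open>m\<close> and \<open>f\<close> shows that it can only hold
  if \<open>m\<close> and \<open>c\<close> are even (\<open>square_times_odd_parity\<close>).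
\<close>

(* Both imported theories define a constant named order; here it denotes the order of a group. *)
hide_const (open) Polynomial.order

section \<open>Multilinear algebra in coordinates\<close>

lemma linear_map_iff:
  "linear_map (f :: 'k::field ^ 'i \<Rightarrow> 'k ^ 'j) \<longleftrightarrow>
     (\<forall>x y. f (x + y) = f x + f y) \<and> (\<forall>c x. f (c *s x) = c *s f x)"
  by (auto simp: Vector_Spaces.linear_iff intro: vec.vector_space_axioms)

lemma linear_form_iff:
  "linear_form (f :: 'k::field ^ 'i \<Rightarrow> 'k) \<longleftrightarrow>
     (\<forall>x y. f (x + y) = f x + f y) \<and> (\<forall>c x. f (c *s x) = c * f x)"
  by (auto simp: Vector_Spaces.linear_iff
      intro: vec.vector_space_axioms vector_space_over_itself.vector_space_axioms)

lemma linear_map_0: "linear_map (f :: 'k::field ^ 'i \<Rightarrow> 'k ^ 'j) \<Longrightarrow> f 0 = 0"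
  by (metis add_cancel_right_right linear_map_iff)

lemma linear_map_sum:
  "linear_map (f :: 'k::field ^ 'i \<Rightarrow> 'k ^ 'j) \<Longrightarrow> f (\<Sum>a\<in>A. g a) = (\<Sum>a\<in>A. f (g a))"
  by (induction A rule: infinite_finite_induct) (auto simp: linear_map_0 linear_map_iff)

lemma vec_expand: "(\<Sum>i\<in>UNIV. x $ i *s axis i 1) = (x :: 'k::field ^ 'i)"
  by (rule basis_expansion)

lemma linear_map_expand:
  assumes "linear_map (f :: 'k::field ^ 'i \<Rightarrow> 'k ^ 'j)"
  shows "(\<Sum>i\<in>UNIV. x $ i *s f (axis i 1)) = f x"
proof -
  have "f x = f (\<Sum>i\<in>UNIV. x $ i *s axis i 1)" by (simp add: vec_expand)
  also have "\<dots> = (\<Sum>i\<in>UNIV. x $ i *s f (axis i 1))"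
    using assms by (simp add: linear_map_sum linear_map_iff)
  finally show ?thesis ..
qed

text \<open>
  The linear extension of a function on basis elements. Every linear form is of this shape, so a
  statement about all linear forms is a statement about scalar-valued functions on the index type.
\<close>

definition lin :: "('i \<Rightarrow> 'k) \<Rightarrow> 'k::field ^ 'i \<Rightarrow> 'k" where
  "lin \<phi> x = (\<Sum>i\<in>UNIV. x $ i * \<phi> i)"

lemma lin_add: "lin \<phi> (x + y) = lin \<phi> x + lin \<phi> y"
  and lin_scale: "lin \<phi> (c *s x) = c * lin \<phi> x"
  and lin_diff: "lin \<phi> (x - y) = lin \<phi> x - lin \<phi> y"
  and lin_zero: "lin \<phi> 0 = 0"
  by (simp_all add: lin_def sum.distrib sum_subtractf sum_distrib_left algebra_simps)

lemma lin_axis: "lin \<phi> (axis i 1) = \<phi> i"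
  by (simp add: lin_def axis_def if_distrib if_distribR cong: if_cong)

lemma lin_sum: "lin \<phi> (\<Sum>a\<in>A. g a) = (\<Sum>a\<in>A. lin \<phi> (g a))"
  by (induction A rule: infinite_finite_induct) (auto simp: lin_add lin_zero)

lemmas lin_simps = lin_add lin_scale lin_diff lin_zero lin_axis lin_sum

lemma linear_form_lin: "linear_form (lin \<phi>)"
  by (simp add: linear_form_iff lin_simps)

lemma linear_form_0: "linear_form (L :: 'k::field ^ 'i \<Rightarrow> 'k) \<Longrightarrow> L 0 = 0"
  by (metis add_cancel_right_right linear_form_iff)

lemma linear_form_sum:
  "linear_form (L :: 'k::field ^ 'i \<Rightarrow> 'k) \<Longrightarrow> L (\<Sum>a\<in>A. g a) = (\<Sum>a\<in>A. L (g a))"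
  by (induction A rule: infinite_finite_induct) (auto simp: linear_form_0 linear_form_iff)

lemma linear_form_eq_lin:
  assumes "linear_form L" shows "L x = lin (\<lambda>i. L (axis i 1)) x"
proof -
  have "L (\<Sum>i\<in>UNIV. x $ i *s axis i 1) = (\<Sum>i\<in>UNIV. x $ i * L (axis i 1))"
    using assms by (simp add: linear_form_sum linear_form_iff)
  then show ?thesis by (simp add: vec_expand lin_def)
qed

text \<open>
  The values on the basis of the tensor product of two linear forms; see \<open>lin_tform_tens\<close>.
\<close>

definition tform :: "('i \<Rightarrow> 'k::field) \<Rightarrow> ('j \<Rightarrow> 'k) \<Rightarrow> 'i \<times> 'j \<Rightarrow> 'k" where
  "tform \<phi> \<psi> p = \<phi> (fst p) * \<psi> (snd p)"

lemma sum_UNIV_prod: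
  "(\<Sum>p\<in>(UNIV :: ('i::finite \<times> 'j::finite) set). F p) = (\<Sum>i\<in>UNIV. \<Sum>j\<in>UNIV. F (i, j))"
  by (simp add: UNIV_Times_UNIV[symmetric] sum.cartesian_product del: UNIV_Times_UNIV)

lemma lin_tform_tens: "lin (tform \<phi> \<psi>) (x \<boxtimes> y) = lin \<phi> x * lin \<psi> y"
  by (simp add: lin_def sum_UNIV_prod tens_def tform_def sum_product mult_ac)

lemma tens_axis: "(axis i 1 :: 'k::field ^ 'i) \<boxtimes> (axis j 1 :: 'k ^ 'j) = axis (i, j) 1"
  by (auto simp: vec_eq_iff tens_def axis_def)

lemma tens_add_left: "(x + y) \<boxtimes> z = x \<boxtimes> z + y \<boxtimes> z"
  and tens_add_right: "z \<boxtimes> (x + y) = z \<boxtimes> x + z \<boxtimes> y"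
  and tens_scale_left: "(c *s x) \<boxtimes> z = c *s (x \<boxtimes> z)"
  and tens_scale_right: "z \<boxtimes> (c *s x) = c *s (z \<boxtimes> x)"
  by (simp_all add: vec_eq_iff tens_def algebra_simps)

lemmas tens_simps = tens_add_left tens_add_right tens_scale_left tens_scale_right

lemma scale_sum: "c *s (\<Sum>a\<in>A. g a) = (\<Sum>a\<in>A. c *s (g a :: 'k::field ^ 'i))"
  by (induction A rule: infinite_finite_induct) (auto simp: vec.scale_right_distrib)

lemma sweedler2_add: "sweedler2 (s + t) b = sweedler2 s b + sweedler2 t b"
  and sweedler2_scale: "sweedler2 (c *s t) b = c *s sweedler2 t b"
  by (simp_all add: sweedler2_def vec.scale_left_distrib sum.distrib scale_sum)

lemma sweedler3_add: "sweedler3 (s + t) B = sweedler3 s B + sweedler3 t B"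
  and sweedler3_scale: "sweedler3 (c *s t) B = c *s sweedler3 t B"
  by (simp_all add: sweedler3_def vec.scale_left_distrib sum.distrib scale_sum)

subsection \<open>Closure properties of linear maps\<close>

text \<open>
  In the iterated Sweedler sums below each argument occurs once, so backward application of these
  rules proves linearity in it by following the path to that occurrence.
\<close>

named_theorems linear_rules

lemma linear_id [linear_rules]: "linear_map (\<lambda>x. x)"
  and linear_scaled [linear_rules]: "linear_map f \<Longrightarrow> linear_map (\<lambda>x. c *s f x)"
  and linear_form_times [linear_rules]: "linear_form h \<Longrightarrow> linear_map (\<lambda>x. h x *s y)"
  and linear_sum2 [linear_rules]: "linear_map f \<Longrightarrow> linear_map f' \<Longrightarrow> linear_map (\<lambda>x. f x + f' x)"
  and linear_tens_left [linear_rules]: "linear_map f \<Longrightarrow> linear_map (\<lambda>x. f x \<boxtimes> z)"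
  and linear_tens_right [linear_rules]: "linear_map f \<Longrightarrow> linear_map (\<lambda>x. w \<boxtimes> f x)"
  and linear_sweedler2 [linear_rules]: "linear_map f2 \<Longrightarrow> linear_map (\<lambda>x. sweedler2 (f2 x) b)"
  and linear_sweedler3 [linear_rules]: "linear_map f3 \<Longrightarrow> linear_map (\<lambda>x. sweedler3 (f3 x) B)"
  by (simp_all add: linear_map_iff linear_form_iff tens_simps vec.scale_right_distrib vec.scale_left_distrib
      sweedler2_add sweedler2_scale sweedler3_add sweedler3_scale mult_ac)

lemma linear_map_id: "linear_map id"
  by (simp add: linear_map_iff)

lemma linear_comp:
  assumes "linear_map g" "linear_map f" shows "linear_map (\<lambda>x. g (f x))"
  using assms by (simp add: linear_map_iff)

lemma linear_sweedler2_body [linear_rules]: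
  assumes "\<And>u v. linear_map (\<lambda>x. b x u v)"
  shows "linear_map (\<lambda>x. sweedler2 t (b x))"
  using assms by (simp add: linear_map_iff sweedler2_def vec.scale_right_distrib sum.distrib
      scale_sum mult_ac)

lemma linear_sweedler3_body [linear_rules]:
  assumes "\<And>u v w. linear_map (\<lambda>x. b x u v w)"
  shows "linear_map (\<lambda>x. sweedler3 t (b x))"
  using assms by (simp add: linear_map_iff sweedler3_def vec.scale_right_distrib sum.distrib
      scale_sum mult_ac)

subsection \<open>Evaluating Sweedler sums\<close>

lemma sweedler2_tens:
  assumes "\<And>x. linear_map (b x)" "\<And>y. linear_map (\<lambda>x. b x y)"
  shows "sweedler2 (x \<boxtimes> y) b = b x y"
proof -
  have "sweedler2 (x \<boxtimes> y) b =
      (\<Sum>i\<in>UNIV. x $ i *s (\<Sum>j\<in>UNIV. y $ j *s b (axis i 1) (axis j 1)))"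
    by (simp add: sweedler2_def tens_def scale_sum)
  also have "\<dots> = (\<Sum>i\<in>UNIV. x $ i *s b (axis i 1) y)"
    using linear_map_expand[OF assms(1)] by simp
  also have "\<dots> = b x y"
    using linear_map_expand[OF assms(2), of x y] .
  finally show ?thesis .
qed

lemma sweedler3_tens:
  assumes "\<And>x y. linear_map (b x y)" "\<And>x z. linear_map (\<lambda>y. b x y z)"
    "\<And>y z. linear_map (\<lambda>x. b x y z)"
  shows "sweedler3 (x \<boxtimes> y \<boxtimes> z) b = b x y z"
proof -
  have "sweedler3 (x \<boxtimes> y \<boxtimes> z) b = (\<Sum>i\<in>UNIV. x $ i *s (\<Sum>j\<in>UNIV. y $ j *s
      (\<Sum>l\<in>UNIV. z $ l *s b (axis i 1) (axis j 1) (axis l 1))))"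
    by (simp add: sweedler3_def tens_def scale_sum mult_ac)
  also have "\<dots> = (\<Sum>i\<in>UNIV. x $ i *s (\<Sum>j\<in>UNIV. y $ j *s b (axis i 1) (axis j 1) z))"
    using linear_map_expand[OF assms(1)] by simp
  also have "\<dots> = (\<Sum>i\<in>UNIV. x $ i *s b (axis i 1) y z)"
    using linear_map_expand[OF assms(2), of y] by simp
  also have "\<dots> = b x y z"
    using linear_map_expand[OF assms(3), of x y z] .
  finally show ?thesis .
qed

lemma sum_scale_left: "(\<Sum>a\<in>A. f a) *s (z :: 'k::field ^ 'i) = (\<Sum>a\<in>A. f a *s z)"
  by (induction A rule: infinite_finite_induct) (auto simp: vec.scale_left_distrib)

text \<open>
  When each tensor factor acts by a scalar, or the result is only tested against a linear form that
  is multiplicative in the factors, a Sweedler sum collapses to one scalar: the tensor evaluated at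
  a product of linear forms. This lemma and its variants below replace the iterated sums of the
  axioms by such evaluations.
\<close>

lemma sweedler2_eigen:
  assumes "\<And>a b. F (axis a 1) (axis b 1) = (\<phi> a * \<psi> b) *s z"
  shows "sweedler2 t F = lin (tform \<phi> \<psi>) t *s z"
  by (simp add: sweedler2_def assms lin_def sum_UNIV_prod tform_def sum_scale_left mult_ac)

lemma sweedler3_eigen:
  assumes "\<And>a b c. F (axis a 1) (axis b 1) (axis c 1) = (\<phi> a * \<psi> b * \<theta> c) *s z"
  shows "sweedler3 t F = lin (tform \<phi> (tform \<psi> \<theta>)) t *s z"
  by (simp add: sweedler3_def assms lin_def sum_UNIV_prod tform_def sum_scale_left mult_ac)

lemma lin_sweedler2:
  assumes "\<And>a b. lin L (F (axis a 1) (axis b 1)) = \<phi> a * \<psi> b * \<kappa>"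
  shows "lin L (sweedler2 t F) = lin (tform \<phi> \<psi>) t * \<kappa>"
  by (simp add: sweedler2_def lin_sum lin_scale assms)
     (simp add: lin_def sum_UNIV_prod tform_def sum_distrib_left mult_ac)

lemma lin_sweedler3:
  assumes "\<And>a b c. lin L (F (axis a 1) (axis b 1) (axis c 1)) = \<phi> a * \<psi> b * \<theta> c * \<kappa>"
  shows "lin L (sweedler3 t F) = lin (tform \<phi> (tform \<psi> \<theta>)) t * \<kappa>"
  by (simp add: sweedler3_def lin_sum lin_scale assms)
     (simp add: lin_def sum_UNIV_prod tform_def sum_distrib_left mult_ac)

lemma tens_map_tens:
  assumes "linear_map f" "linear_map g"
  shows "tens_map f g (x \<boxtimes> y) = f x \<boxtimes> g y"
  unfolding tens_map_def by (rule sweedler2_tens) (intro linear_rules assms)+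

lemma linear_tens_map: "linear_map (tens_map f g)"
  unfolding tens_map_def by (intro linear_rules)

lemma tens_map_scale: "tens_map f g (c *s t) = c *s tens_map f g t"
  and tens_map_add: "tens_map f g (s + t) = tens_map f g s + tens_map f g t"
  using linear_tens_map[of f g] by (auto simp: linear_map_iff)

section \<open>Roots of unity\<close>

lemma primitive_root_power_eq_1_iff:
  fixes z :: "'k::field"
  assumes "primitive_root_of_unity n z"
  shows "z ^ k = 1 \<longleftrightarrow> n dvd k"
proof
  have n: "n > 0" "z ^ n = 1" "\<And>d. 0 < d \<Longrightarrow> d < n \<Longrightarrow> z ^ d \<noteq> 1"
    using assms by (auto simp: primitive_root_of_unity_def)
  have red: "z ^ k = z ^ (k mod n)"
    by (metis mod_mult_div_eq mult_1_right n(2) power_add power_mult power_one)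
  {
    assume "z ^ k = 1"
    with red n(3)[of "k mod n"] have "k mod n = 0" using n(1) mod_less_divisor by fastforce
    then show "n dvd k" by presburger
  }
  assume "n dvd k"
  then show "z ^ k = 1" using n by (metis dvd_def power_mult power_one)
qed

lemma primitive_root_nonzero:
  fixes z :: "'k::field"
  assumes "primitive_root_of_unity n z" shows "z \<noteq> 0"
  using assms by (auto simp: primitive_root_of_unity_def power_0_left)

lemma primitive_root_inj:
  fixes z :: "'k::field"
  assumes "primitive_root_of_unity n z"
  shows "inj_on (\<lambda>j. z ^ j) {..<n}"
proof (rule inj_onI)
  have *: "i = j" if "i \<le> j" "j < n" "z ^ i = z ^ j" for i j
  proof -
    have "z ^ i * z ^ (j - i) = z ^ j" using that(1) by (simp flip: power_add)
    with that have "z ^ i * z ^ (j - i) = z ^ i * 1" by simp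
    then have "z ^ (j - i) = 1" using primitive_root_nonzero[OF assms] by simp
    then have "n dvd j - i" using primitive_root_power_eq_1_iff[OF assms] by blast
    then have "j - i = 0" using that by (auto dest: dvd_imp_le)
    then show ?thesis using that by simp
  qed
  show "i = j" if "i \<in> {..<n}" "j \<in> {..<n}" "z ^ i = z ^ j" for i j
  proof (cases "i \<le> j")
    case True then show ?thesis using that *[OF True] by blast
  next
    case False
    then have "j \<le> i" by simp
    from *[OF this _ that(3)[symmetric]] that show ?thesis by blast
  qed
qed

text \<open>
  The powers of a primitive root already exhaust the at most \<open>n\<close> roots of \<open>X\<^sup>n - 1\<close>.
\<close>

lemma root_of_unity_is_power:
  fixes z y :: "'k::field"
  assumes z: "primitive_root_of_unity n z" and y: "y ^ n = 1"
  shows "\<exists>j<n. y = z ^ j"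
proof -
  define p :: "'k poly" where "p = monom 1 n - 1"
  have n: "n > 0" using z by (simp add: primitive_root_of_unity_def)
  have deg: "degree p \<le> n" unfolding p_def
    by (intro degree_diff_le degree_monom_le) auto
  have "coeff p n = 1" using n by (simp add: p_def)
  then have "p \<noteq> 0" by auto
  have root: "poly p x = 0 \<longleftrightarrow> x ^ n = 1" for x by (simp add: p_def poly_monom)
  have "(\<lambda>j. z ^ j) ` {..<n} = {x. poly p x = 0}"
  proof (rule card_seteq)
    show "finite {x. poly p x = 0}" by (rule poly_roots_finite) fact
    show "(\<lambda>j. z ^ j) ` {..<n} \<subseteq> {x. poly p x = 0}"
    proof (clarsimp simp: root)
      fix j
      have "(z ^ j) ^ n = (z ^ n) ^ j" by (simp add: mult.commute flip: power_mult)
      then show "(z ^ j) ^ n = 1" using z by (simp add: primitive_root_of_unity_def)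
    qed
    show "card {x. poly p x = 0} \<le> card ((\<lambda>j. z ^ j) ` {..<n})"
      using card_poly_roots_bound[OF \<open>p \<noteq> 0\<close>] deg card_image[OF primitive_root_inj[OF z]] by simp
  qed
  moreover have "y \<in> {x. poly p x = 0}" using y root by simp
  ultimately have "y \<in> (\<lambda>j. z ^ j) ` {..<n}" by simp
  then show ?thesis by blast
qed

lemma primitive_root_geometric_sum:
  fixes z :: "'k::field"
  assumes z: "primitive_root_of_unity n z"
  shows "(\<Sum>s<n. (z ^ j) ^ s) = (if n dvd j then of_nat n else 0)"
proof (cases "z ^ j = 1")
  case True
  then have "n dvd j" using primitive_root_power_eq_1_iff[OF z] by blast
  with True show ?thesis by simp
next
  case False
  have "(z ^ j) ^ n = (z ^ n) ^ j" by (simp add: mult.commute flip: power_mult)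
  then have "(z ^ j) ^ n = 1" using z by (simp add: primitive_root_of_unity_def)
  moreover have "\<not> n dvd j" using False primitive_root_power_eq_1_iff[OF z] by simp
  ultimately show ?thesis using False by (simp add: sum_gp_strict)
qed

text \<open>
  If \<open>n\<close> vanished in the field, then \<open>1 + X + \<dots> + X\<^bsup>n-1\<^esup>\<close> would vanish at \<open>1\<close> as well as at the
  other \<open>n - 1\<close> powers of \<open>z\<close>, which is one root more than its degree allows. This is what makes
  the division by \<open>n\<close> in the idempotents harmless.
\<close>

lemma primitive_root_of_nat_nonzero:
  fixes z :: "'k::field"
  assumes z: "primitive_root_of_unity n z"
  shows "(of_nat n :: 'k) \<noteq> 0"
proof
  assume 0: "(of_nat n :: 'k) = 0"
  define p :: "'k poly" where "p = (\<Sum>s<n. monom 1 s)"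
  have n: "n > 0" using z by (simp add: primitive_root_of_unity_def)
  have "coeff p (n - 1) = 1"
    using n by (simp add: p_def coeff_sum)
  then have "p \<noteq> 0" by auto
  have deg: "degree p \<le> n - 1"
    unfolding p_def by (rule degree_sum_le) (auto intro: order.trans[OF degree_monom_le])
  have "poly p (z ^ j) = 0" for j
    using primitive_root_geometric_sum[OF z, of j] 0
    by (simp add: p_def poly_sum poly_monom split: if_splits)
  then have "(\<lambda>j. z ^ j) ` {..<n} \<subseteq> {x. poly p x = 0}" by auto
  from card_mono[OF poly_roots_finite[OF \<open>p \<noteq> 0\<close>] this]
  have "n \<le> card {x. poly p x = 0}" using card_image[OF primitive_root_inj[OF z]] by simp
  with card_poly_roots_bound[OF \<open>p \<noteq> 0\<close>] deg n show False by linarith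
qed

lemma primitive_root_power:
  fixes z :: "'k::field"
  assumes "primitive_root_of_unity (n * l) z" "n > 0" "l > 0"
  shows "primitive_root_of_unity n (z ^ l)"
proof -
  have iff: "z ^ k = 1 \<longleftrightarrow> n * l dvd k" for k by (rule primitive_root_power_eq_1_iff) fact
  have "(z ^ l) ^ d = 1 \<longleftrightarrow> n dvd d" for d
    using assms iff[of "l * d"] by (simp add: mult.commute[of n] flip: power_mult)
  then show ?thesis using assms(2) by (auto simp: primitive_root_of_unity_def dest: dvd_imp_le)
qed

section \<open>The group algebra of a cyclic group as a product of fields\<close>

locale cyclic_reassociator =
  fixes G :: "'g::finite monoid" and g :: 'g and m c :: nat and qq q :: "'k::field"
  assumes grp: "group G" and carr: "carrier G = UNIV" and ord: "order G = m" and m2: "m \<ge> 2"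
    and gen: "generate G {g} = carrier G"
    and prim: "primitive_root_of_unity (m ^ 2) qq" and q_def: "q = qq ^ m"
begin

abbreviation "H \<equiv> kPhi G g q c"

abbreviation pw :: "nat \<Rightarrow> 'g" where "pw s \<equiv> g [^]\<^bsub>G\<^esub> s"

lemma q_prim: "primitive_root_of_unity m q"
  using primitive_root_power[of m m qq] prim m2 by (simp add: q_def power2_eq_square)

lemma q_nz: "q \<noteq> 0" by (rule primitive_root_nonzero[OF q_prim])
lemma qq_nz: "qq \<noteq> 0" by (rule primitive_root_nonzero[OF prim])
lemma m_nz: "(of_nat m :: 'k) \<noteq> 0" by (rule primitive_root_of_nat_nonzero[OF q_prim])
lemma q_pow_m: "q ^ m = 1" using q_prim by (simp add: primitive_root_of_unity_def)

lemma q_mod: "q ^ (k mod m) = q ^ k"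
  by (metis mod_mult_div_eq mult_1_right q_pow_m power_add power_mult power_one)

lemma pw_add: "pw (s + t) = pw s \<otimes>\<^bsub>G\<^esub> pw t"
  by (rule monoid.nat_pow_mult[symmetric]) (use grp carr in \<open>auto simp: group.is_monoid\<close>)

lemma ord_g: "group.ord G g = m"
  using group.generate_pow_card[OF grp, of g] gen ord carr by (simp add: Coset.order_def)

lemma pw_bij: "bij_betw pw {..<m} UNIV"
proof -
  interpret group G by (rule grp)
  have eq: "{0..ord g - 1} = {..<m}" using ord_g m2 by auto
  have inj: "inj_on pw {..<m}" using ord_inj[of g] carr unfolding eq by simp
  moreover have "card (pw ` {..<m}) = card (UNIV :: 'g set)"
    using card_image[OF inj] ord carr by (simp add: Coset.order_def)
  then have "pw ` {..<m} = UNIV" by (intro card_eq_UNIV_imp_eq_UNIV) auto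
  ultimately show ?thesis by (simp add: bij_betw_def)
qed

lemma sum_pw: "(\<Sum>a\<in>UNIV. F a) = (\<Sum>s<m. F (pw s))"
  by (rule sum.reindex_bij_betw[OF pw_bij, symmetric])

definition dlog :: "'g \<Rightarrow> nat" where "dlog a = the_inv_into {..<m} pw a"

lemma pw_dlog: "pw (dlog a) = a" and dlog_less: "dlog a < m"
proof -
  show "pw (dlog a) = a" unfolding dlog_def
    using pw_bij by (intro f_the_inv_into_f_bij_betw) auto
  show "dlog a < m"
    using the_inv_into_into[of pw "{..<m}" a "{..<m}"] pw_bij by (auto simp: dlog_def bij_betw_def)
qed

lemma pw_mod: "pw (s mod m) = pw s"
proof -
  interpret group G by (rule grp)
  have "pw s = pw (m * (s div m) + s mod m)" by simp
  also have "\<dots> = pw (s mod m)" unfolding pw_add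
    using carr nat_pow_pow[of g m "s div m"] pow_ord_eq_1[of g] by (simp add: ord_g)
  finally show ?thesis ..
qed

lemma dlog_pw: "dlog (pw s) = s mod m"
proof -
  have "dlog (pw (s mod m)) = s mod m" unfolding dlog_def
    using pw_bij m2 by (intro the_inv_into_f_f) (auto simp: bij_betw_def)
  then show ?thesis by (simp add: pw_mod)
qed

definition ch :: "nat \<Rightarrow> 'g \<Rightarrow> 'k" where "ch j a = q ^ (j * dlog a)"

lemma ch_pw: "ch j (pw s) = q ^ (j * s)"
  by (metis ch_def dlog_pw mod_mult_right_eq q_mod)

definition character :: "('g \<Rightarrow> 'k) \<Rightarrow> bool" where
  "character \<phi> \<longleftrightarrow> \<phi> \<one>\<^bsub>G\<^esub> = 1 \<and> (\<forall>a b. \<phi> (a \<otimes>\<^bsub>G\<^esub> b) = \<phi> a * \<phi> b)"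

lemma character_ch: "character (ch j)"
proof -
  have "ch j (a \<otimes>\<^bsub>G\<^esub> b) = ch j a * ch j b" for a b
    using ch_pw[of j "dlog a + dlog b"] ch_pw[of j "dlog a"] ch_pw[of j "dlog b"]
    by (simp add: pw_add pw_dlog distrib_left power_add)
  then show ?thesis using ch_pw[of j 0] by (simp add: character_def)
qed

lemma ch_0: "ch 0 = (\<lambda>_. 1)" by (auto simp: ch_def)

lemma ch_mult: "(\<lambda>a. ch i a * ch j a) = ch (i + j)"
  by (auto simp: ch_def distrib_right power_add)

lemma ch_mod: "ch (i mod m) = ch i"
proof
  fix a show "ch (i mod m) a = ch i a"
    unfolding ch_def by (metis mod_mult_left_eq q_mod)
qed

text \<open>
  A character is determined by its value at the generator, an \<open>m\<close>-th root of unity.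
\<close>

lemma character_eq_ch:
  assumes "character \<phi>" shows "\<exists>f<m. \<phi> = ch f"
proof -
  have pow: "\<phi> (pw s) = \<phi> g ^ s" for s
  proof (induction s)
    case 0 then show ?case using assms by (simp add: character_def)
  next
    case (Suc s) then show ?case using assms by (simp add: character_def)
  qed
  have "\<phi> g ^ m = 1"
    using pow[of m] pw_mod[of m] assms by (simp add: character_def)
  then obtain f where f: "f < m" "\<phi> g = q ^ f" using root_of_unity_is_power[OF q_prim] by blast
  have "\<phi> a = ch f a" for a
    using pow[of "dlog a"] f by (simp add: pw_dlog ch_def power_mult)
  then show ?thesis using f by auto
qed

lemma lin_character_mul:
  assumes "character \<phi>" shows "lin \<phi> (ga_mul G x y) = lin \<phi> x * lin \<phi> y"
  using assms by (simp add: ga_mul_def lin_sum lin_scale lin_axis character_def)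
     (simp add: lin_def sum_product mult_ac)

lemma lin_comul: "lin (tform \<phi> \<psi>) (ga_comul x) = lin (\<lambda>a. \<phi> a * \<psi> a) x"
  by (simp add: ga_comul_def lin_sum lin_scale lin_tform_tens lin_axis) (simp add: lin_def)

lemma lin_ch_idem:
  assumes "j < m" shows "lin (ch i) (idem G g q j) = (if i mod m = j then 1 else 0)"
proof -
  \<comment> \<open>Negative powers of \<open>q\<close> are written as \<open>m - j\<close> to stay within natural exponents.\<close>
  have eq: "inverse q ^ (j * s) * q ^ (i * s) = (q ^ (i + (m - j))) ^ s" for s
  proof -
    have "q ^ j * q ^ (m - j) = 1" using assms q_pow_m by (simp flip: power_add)
    then have "inverse q ^ j = q ^ (m - j)"
      using q_nz by (simp add: inverse_unique power_inverse)
    then show ?thesis by (simp add: power_mult power_add power_mult_distrib)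
  qed
  have "lin (ch i) (idem G g q j) = (\<Sum>s<m. inverse q ^ (j * s) * q ^ (i * s)) / of_nat m"
    by (simp add: idem_def ord lin_sum lin_scale lin_axis ch_pw sum_divide_distrib)
  also have "\<dots> = (if m dvd i + (m - j) then 1 else 0)"
    unfolding eq using primitive_root_geometric_sum[OF q_prim] m_nz by simp
  also have "m dvd i + (m - j) \<longleftrightarrow> i mod m = j"
  proof -
    have "int (i + (m - j)) = (int i - int j) + int m" using assms by simp
    then have "m dvd i + (m - j) \<longleftrightarrow> int m dvd (int i - int j) + int m"
      by (metis of_nat_dvd_iff)
    also have "\<dots> \<longleftrightarrow> int m dvd int i - int j" by simp
    also have "\<dots> \<longleftrightarrow> int i mod int m = int j mod int m" by (rule mod_eq_dvd_iff[symmetric])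
    also have "\<dots> \<longleftrightarrow> i mod m = j" using assms by (metis mod_less of_nat_eq_iff zmod_int)
    finally show ?thesis .
  qed
  finally show ?thesis .
qed

text \<open>
  The idempotents form the basis dual to the characters, by orthogonality of the powers of \<open>q\<close>.
  Consequently equations in \<open>k[G]\<close> and its tensor powers may be checked on characters, where
  multiplication and comultiplication become transparent.
\<close>

lemma fourier_expansion: "(\<Sum>j<m. lin (ch j) x *s idem G g q j) = x"
proof -
  have coeff: "idem G g q j $ pw t = inverse q ^ (j * t) / of_nat m" if "t < m" for j t
  proof -
    have "idem G g q j $ pw t =
       (\<Sum>s<m. inverse q ^ (j * s) / of_nat m * (if pw t = pw s then 1 else 0))"
      by (simp add: idem_def ord axis_def)
    also have "\<dots> = (\<Sum>s<m. if s = t then inverse q ^ (j * s) / of_nat m else 0)"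
      using pw_bij that by (intro sum.cong) (auto simp: bij_betw_def inj_on_def)
    finally show ?thesis using that by simp
  qed
  have "(\<Sum>j<m. lin (ch j) x *s idem G g q j) $ pw t = x $ pw t" if t: "t < m" for t
  proof -
    have eq: "q ^ (j * s) * inverse q ^ (j * t) = (q ^ (s + (m - t))) ^ j" for s j
    proof -
      have "q ^ t * q ^ (m - t) = 1" using t q_pow_m by (simp flip: power_add)
      then have "inverse q ^ t = q ^ (m - t)"
        using q_nz by (simp add: inverse_unique power_inverse)
      then show ?thesis
        by (simp add: power_mult power_add power_mult_distrib mult.commute[of j])
    qed
    have dvd: "m dvd s + (m - t) \<longleftrightarrow> s = t" if "s < m" for s
    proof -
      have "m dvd s + (m - t) \<longleftrightarrow> s + (m - t) = m"
      proof
        assume "m dvd s + (m - t)"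
        then obtain k where k: "s + (m - t) = m * k" by (auto simp: dvd_def)
        with that t have "0 < m * k" "m * k < m * 2" by linarith+
        then have "k = 1" by auto
        with k show "s + (m - t) = m" by simp
      qed simp
      then show ?thesis using t by auto
    qed
    have "(\<Sum>j<m. lin (ch j) x *s idem G g q j) $ pw t =
        (\<Sum>j<m. (\<Sum>s<m. x $ pw s * q ^ (j * s)) * (inverse q ^ (j * t) / of_nat m))"
      by (simp add: coeff[OF t] lin_def sum_pw ch_pw)
    also have "\<dots> = (\<Sum>s<m. x $ pw s * ((\<Sum>j<m. q ^ (j * s) * inverse q ^ (j * t)) / of_nat m))"
      by (simp add: sum_distrib_left sum_distrib_right sum_divide_distrib mult_ac)
         (subst sum.swap, simp add: mult_ac)
    also have "\<dots> = (\<Sum>s<m. x $ pw s * (if s = t then 1 else 0))"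
      unfolding eq using primitive_root_geometric_sum[OF q_prim] m_nz dvd
      by (intro sum.cong) auto
    finally show ?thesis using t by (simp add: if_distrib cong: if_cong)
  qed
  then have "(\<Sum>j<m. lin (ch j) x *s idem G g q j) $ a = x $ a" for a
    using dlog_less[of a] pw_dlog[of a] by metis
  then show ?thesis by (simp add: vec_eq_iff)
qed

lemma ch_separate:
  assumes "\<And>j. j < m \<Longrightarrow> lin (ch j) x = lin (ch j) y" shows "x = y"
proof -
  have "(\<Sum>j<m. lin (ch j) x *s idem G g q j) = (\<Sum>j<m. lin (ch j) y *s idem G g q j)"
    using assms by (intro sum.cong) auto
  then show ?thesis by (simp add: fourier_expansion)
qed

lemma ch_separate_tens:
  fixes s t :: "'k ^ ('g \<times> 'i::finite)"
  assumes sep: "\<And>x y :: 'k ^ 'i. (\<And>L. L \<in> \<L> \<Longrightarrow> lin L x = lin L y) \<Longrightarrow> x = y"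
    and eq: "\<And>j L. j < m \<Longrightarrow> L \<in> \<L> \<Longrightarrow> lin (tform (ch j) L) s = lin (tform (ch j) L) t"
  shows "s = t"
proof -
  \<comment> \<open>Characters separate the slices along the first factor, and \<open>\<L>\<close> separates points of a slice.\<close>
  define row where "row r a = (\<chi> i. r $ (a, i))" for r :: "'k ^ ('g \<times> 'i)" and a
  have row: "lin (tform \<phi> L) r = lin \<phi> (\<chi> a. lin L (row r a))" for \<phi> L r
    by (simp add: lin_def sum_UNIV_prod tform_def row_def sum_distrib_left mult_ac)
  have "row s a = row t a" for a
  proof (rule sep)
    fix L assume "L \<in> \<L>"
    then have "(\<chi> a. lin L (row s a)) = (\<chi> a. lin L (row t a))"
      using eq by (intro ch_separate) (simp add: row)
    then show "lin L (row s a) = lin L (row t a)" by (simp add: vec_eq_iff)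
  qed
  then show ?thesis by (auto simp: row_def vec_eq_iff)
qed

lemma ch_separate3:
  assumes "\<And>i j l. i < m \<Longrightarrow> j < m \<Longrightarrow> l < m \<Longrightarrow>
     lin (tform (ch i) (tform (ch j) (ch l))) s = lin (tform (ch i) (tform (ch j) (ch l))) t"
  shows "s = t"
proof (rule ch_separate_tens[where \<L> = "{tform (ch j) (ch l) | j l. j < m \<and> l < m}"])
  fix x y :: "'k ^ ('g \<times> 'g)"
  assume *: "\<And>L. L \<in> {tform (ch j) (ch l) | j l. j < m \<and> l < m} \<Longrightarrow> lin L x = lin L y"
  show "x = y"
    by (rule ch_separate_tens[where \<L> = "ch ` {..<m}"]) (auto intro: ch_separate *)
qed (use assms in auto)

section \<open>The reassociator on characters\<close>

lemma lin_mul3: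
  assumes "character \<phi>" "character \<psi>" "character \<theta>"
  shows "lin (tform \<phi> (tform \<psi> \<theta>)) (mul3 H s t) =
    lin (tform \<phi> (tform \<psi> \<theta>)) s * lin (tform \<phi> (tform \<psi> \<theta>)) t"
  unfolding mul3_def
  by (rule lin_sweedler3, subst lin_sweedler3[where \<phi> = \<phi> and \<psi> = \<psi> and \<theta> = \<theta>])
     (auto simp: kPhi_def Let_def lin_tform_tens lin_character_mul assms lin_axis mult_ac)

lemma lin_one3:
  assumes "character \<phi>" "character \<psi>" "character \<theta>"
  shows "lin (tform \<phi> (tform \<psi> \<theta>)) (one3 H) = 1"
  using assms by (simp add: one3_def kPhi_def Let_def lin_tform_tens lin_axis character_def)

text \<open>
  The elements of \<open>k[G]\<^sup>\<otimes>\<^sup>3\<close> expressed by their values on triples of characters. The reassociator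
  and its inverse are both given in this form.
\<close>

definition diag3 :: "(nat \<Rightarrow> nat \<Rightarrow> nat \<Rightarrow> 'k) \<Rightarrow> 'k ^ ('g \<times> 'g \<times> 'g)" where
  "diag3 w = (\<Sum>i<m. \<Sum>j<m. \<Sum>l<m. w i j l *s (idem G g q i \<boxtimes> idem G g q j \<boxtimes> idem G g q l))"

lemma lin_diag3:
  "lin (tform (ch i) (tform (ch j) (ch l))) (diag3 w) = w (i mod m) (j mod m) (l mod m)"
proof -
  have sum1: "(\<Sum>i'<m. F i' * (if i mod m = i' then 1 else 0)) = F (i mod m)"
    for i and F :: "nat \<Rightarrow> 'k" using m2 by (simp add: if_distrib cong: if_cong)
  have "lin (tform (ch i) (tform (ch j) (ch l))) (diag3 w) =
      (\<Sum>i'<m. \<Sum>j'<m. \<Sum>l'<m. w i' j' l' * ((if i mod m = i' then 1 else 0) *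
         ((if j mod m = j' then 1 else 0) * (if l mod m = l' then 1 else 0))))"
    unfolding diag3_def lin_sum lin_scale lin_tform_tens by (intro sum.cong refl) (simp only: lin_ch_idem lessThan_iff)
  also have "\<dots> = (\<Sum>i'<m. (\<Sum>j'<m. (\<Sum>l'<m. w i' j' l' * (if l mod m = l' then 1 else 0))
         * (if j mod m = j' then 1 else 0)) * (if i mod m = i' then 1 else 0))"
    unfolding sum_distrib_right by (intro sum.cong refl) (simp only: mult_ac)
  also have "\<dots> = w (i mod m) (j mod m) (l mod m)" by (simp only: sum1)
  finally show ?thesis .
qed

lemma reassoc_diag3: "reassoc H = diag3 (\<lambda>i j l. q ^ (c * i * ((j + l) div m)))"
  by (simp add: kPhi_def Let_def ord diag3_def)

text \<open>
  Multiplication in \<open>k[G]\<^sup>\<otimes>\<^sup>3\<close> is pointwise multiplication of values on character triples, and these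
  values determine an element; so the inverse is unique and is obtained by inverting the values.
\<close>

lemma reassoc_inv_diag3:
  "reassoc_inv H = diag3 (\<lambda>i j l. inverse (q ^ (c * i * ((j + l) div m))))" (is "_ = ?t")
  unfolding reassoc_inv_def
proof (rule the_equality)
  show "mul3 H (reassoc H) ?t = one3 H \<and> mul3 H ?t (reassoc H) = one3 H"
    using q_nz by (intro conjI ch_separate3)
      (simp_all add: lin_mul3 lin_one3 character_ch reassoc_diag3 lin_diag3)
  fix t assume t: "mul3 H (reassoc H) t = one3 H \<and> mul3 H t (reassoc H) = one3 H"
  show "t = ?t"
  proof (rule ch_separate3)
    fix i j l
    let ?L = "lin (tform (ch i) (tform (ch j) (ch l)))"
    have "?L (reassoc H) * ?L t = 1"
      using t lin_mul3[of "ch i" "ch j" "ch l" "reassoc H" t] lin_one3[of "ch i" "ch j" "ch l"]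
      by (simp add: character_ch)
    then show "?L t = ?L ?t"
      by (simp add: reassoc_diag3 lin_diag3 inverse_unique)
  qed
qed

lemma reassoc_ch: "lin (tform (ch i) (tform (ch j) (ch l))) (reassoc H) =
    q ^ (c * (i mod m) * ((j mod m + l mod m) div m))"
  by (simp add: reassoc_diag3 lin_diag3)

lemma reassoc_inv_ch: "lin (tform (ch i) (tform (ch j) (ch l))) (reassoc_inv H) =
    inverse (q ^ (c * (i mod m) * ((j mod m + l mod m) div m)))"
  by (simp add: reassoc_inv_diag3 lin_diag3)

lemma reassoc_normalised:
  "lin (tform (ch 0) (tform (ch j) (ch l))) (reassoc H) = 1"
  "lin (tform (ch i) (tform (ch 0) (ch l))) (reassoc H) = 1"
  "lin (tform (ch i) (tform (ch j) (ch 0))) (reassoc H) = 1"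
  "lin (tform (ch 0) (tform (ch j) (ch l))) (reassoc_inv H) = 1"
  "lin (tform (ch i) (tform (ch 0) (ch l))) (reassoc_inv H) = 1"
  "lin (tform (ch i) (tform (ch j) (ch 0))) (reassoc_inv H) = 1"
  using m2 by (simp_all add: reassoc_ch reassoc_inv_ch)

end

section \<open>Structure maps on weight vectors\<close>

text \<open>
  A common eigenvector of the action. Its eigenvalues are recorded on basis elements only, since
  they extend linearly.
\<close>

definition weight_vector ::
  "('k::field, 'h::finite, 'm::finite, 'z) yd_scheme \<Rightarrow> ('h \<Rightarrow> 'k) \<Rightarrow> 'k ^ 'm \<Rightarrow> bool" where
  "weight_vector M \<phi> x \<longleftrightarrow> (\<forall>h. act M h x = lin \<phi> h *s x)"

lemma linear_act_tensor: "linear_map (act (yd_tensor K M N) h)"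
  unfolding yd_tensor_def yd.simps by (intro linear_rules)

lemma linear_yd_assoc: "linear_map (yd_assoc K M N P)"
  unfolding yd_assoc_def[abs_def] by (intro linear_rules)

lemma linear_yd_assoc_inv: "linear_map (yd_assoc_inv K M N P)"
  unfolding yd_assoc_inv_def[abs_def] by (intro linear_rules)

lemma linear_yd_braiding: "linear_map (yd_braiding M N)"
  unfolding yd_braiding_def[abs_def] by (intro linear_rules)

lemma linear_coact_tensor: "linear_map (coact (yd_tensor K M N))"
  by (simp add: yd_tensor_def linear_map_iff sweedler2_add sweedler2_scale)

lemmas linear_yd_maps = linear_yd_assoc linear_yd_assoc_inv linear_yd_braiding linear_coact_tensor

lemma yd_interchange_linear: "linear_map (yd_interchange K M N P Q)"
  unfolding yd_interchange_def comp_def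
  by (intro linear_yd_maps linear_tens_map linear_comp[OF linear_yd_assoc]
      linear_comp[OF linear_yd_assoc_inv] linear_comp[OF linear_tens_map])

lemma yd_assoc_weight:
  assumes lin: "\<And>h. linear_map (act M h)" "\<And>h. linear_map (act N h)" "\<And>h. linear_map (act P h)"
    and "weight_vector M \<phi> x" "weight_vector N \<psi> y" "weight_vector P \<theta> z"
  shows "yd_assoc K M N P ((x \<boxtimes> y) \<boxtimes> z) =
    lin (tform \<phi> (tform \<psi> \<theta>)) (reassoc K) *s (x \<boxtimes> y \<boxtimes> z)"
proof -
  have "yd_assoc K M N P ((x \<boxtimes> y) \<boxtimes> z) =
     sweedler3 (reassoc K) (\<lambda>a b c. act M a x \<boxtimes> act N b y \<boxtimes> act P c z)"
    unfolding yd_assoc_def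
    by (subst sweedler2_tens, intro linear_rules linear_comp[OF lin(3)], intro linear_rules,
        subst sweedler2_tens, intro linear_rules linear_comp[OF lin(2)],
        intro linear_rules linear_comp[OF lin(1)], rule refl)
  also have "\<dots> = lin (tform \<phi> (tform \<psi> \<theta>)) (reassoc K) *s (x \<boxtimes> y \<boxtimes> z)"
    by (rule sweedler3_eigen)
       (use assms in \<open>simp add: weight_vector_def lin_axis tens_simps mult_ac\<close>)
  finally show ?thesis .
qed

lemma yd_assoc_inv_weight:
  assumes lin: "\<And>h. linear_map (act M h)" "\<And>h. linear_map (act N h)" "\<And>h. linear_map (act P h)"
    and "weight_vector M \<phi> x" "weight_vector N \<psi> y" "weight_vector P \<theta> z"
  shows "yd_assoc_inv K M N P (x \<boxtimes> y \<boxtimes> z) =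
    lin (tform \<phi> (tform \<psi> \<theta>)) (reassoc_inv K) *s ((x \<boxtimes> y) \<boxtimes> z)"
proof -
  have "yd_assoc_inv K M N P (x \<boxtimes> y \<boxtimes> z) =
     sweedler3 (reassoc_inv K) (\<lambda>a b c. (act M a x \<boxtimes> act N b y) \<boxtimes> act P c z)"
    unfolding yd_assoc_inv_def
    by (subst sweedler3_tens, intro linear_rules linear_comp[OF lin(3)],
        intro linear_rules linear_comp[OF lin(2)],
        intro linear_rules linear_comp[OF lin(1)], rule refl)
  also have "\<dots> = lin (tform \<phi> (tform \<psi> \<theta>)) (reassoc_inv K) *s ((x \<boxtimes> y) \<boxtimes> z)"
    by (rule sweedler3_eigen)
       (use assms in \<open>simp add: weight_vector_def lin_axis tens_simps mult_ac\<close>)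
  finally show ?thesis .
qed

lemma yd_braiding_weight:
  assumes lin: "linear_map (coact M)" "bilinear_map (act N)"
    and "coact M x = v \<boxtimes> x" "weight_vector N \<psi> y"
  shows "yd_braiding M N (x \<boxtimes> y) = lin \<psi> v *s (y \<boxtimes> x)"
proof -
  have lin': "linear_map (act N h)" "linear_map (\<lambda>h. act N h n)" for h n
    using lin(2) by (auto simp: bilinear_map_def)
  have "yd_braiding M N (x \<boxtimes> y) = sweedler2 (v \<boxtimes> x) (\<lambda>u m'. act N u y \<boxtimes> m')"
    unfolding yd_braiding_def assms(3)[symmetric]
    by (subst sweedler2_tens, intro linear_rules linear_comp[OF lin'(1)],
        intro linear_rules linear_comp[OF lin(1)], rule refl)
  also have "\<dots> = act N v y \<boxtimes> x"
    by (rule sweedler2_tens) (intro linear_rules linear_comp[OF lin'(2)])+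
  finally show ?thesis using assms by (simp add: weight_vector_def tens_simps)
qed

context cyclic_reassociator
begin

lemma weight_vector_tensor:
  assumes lin: "\<And>h. linear_map (act M h)" "\<And>h. linear_map (act N h)"
    and "weight_vector M \<phi> x" "weight_vector N \<psi> y"
  shows "weight_vector (yd_tensor H M N) (\<lambda>a. \<phi> a * \<psi> a) (x \<boxtimes> y)"
  unfolding weight_vector_def
proof
  fix h
  have "act (yd_tensor H M N) h (x \<boxtimes> y) =
     sweedler2 (hcomul H h) (\<lambda>h\<^sub>1 h\<^sub>2. act M h\<^sub>1 x \<boxtimes> act N h\<^sub>2 y)"
    unfolding yd_tensor_def
    by (simp, subst sweedler2_tens, intro linear_rules linear_comp[OF lin(2)],
        intro linear_rules linear_comp[OF lin(1)], rule refl)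
  also have "\<dots> = lin (tform \<phi> \<psi>) (hcomul H h) *s (x \<boxtimes> y)"
    by (rule sweedler2_eigen)
       (use assms in \<open>simp add: weight_vector_def lin_axis tens_simps mult_ac\<close>)
  also have "hcomul H h = ga_comul h" by (simp add: kPhi_def Let_def)
  finally show "act (yd_tensor H M N) h (x \<boxtimes> y) = lin (\<lambda>a. \<phi> a * \<psi> a) h *s (x \<boxtimes> y)"
    by (simp add: lin_comul)
qed

text \<open>
  All five constituents of the interchange map send weight vectors to multiples of weight vectors, so
  on weight vectors it is the flip of the middle factors up to a product of five scalars: four
  values of the reassociator or its inverse, and the braiding scalar.
\<close>

lemma yd_interchange_weight:
  assumes B: "yd_module H B"
    and w: "weight_vector B \<phi> x" "weight_vector B \<psi> y" "weight_vector B \<theta> z" "weight_vector B \<kappa> t"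
    and y: "coact B y = v \<boxtimes> y"
  shows "yd_interchange H B B B B ((x \<boxtimes> y) \<boxtimes> (z \<boxtimes> t)) =
    (lin (tform \<phi> (tform \<psi> (\<lambda>a. \<theta> a * \<kappa> a))) (reassoc H) *
     lin (tform \<psi> (tform \<theta> \<kappa>)) (reassoc_inv H) * lin \<theta> v *
     lin (tform \<theta> (tform \<psi> \<kappa>)) (reassoc H) *
     lin (tform \<phi> (tform \<theta> (\<lambda>a. \<psi> a * \<kappa> a))) (reassoc_inv H)) *s ((x \<boxtimes> z) \<boxtimes> (y \<boxtimes> t))"
proof -
  have bil: "bilinear_map (act B)" and co: "linear_map (coact B)"
    using B by (auto simp: yd_module_def)
  have lin: "\<And>h. linear_map (act B h)" using bil by (simp add: bilinear_map_def)
  have [simp]: "yd_assoc H B B (yd_tensor H B B) (c *s r) = c *s yd_assoc H B B (yd_tensor H B B) r"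
    "yd_assoc_inv H B B (yd_tensor H B B) (c *s s) = c *s yd_assoc_inv H B B (yd_tensor H B B) s"
    "yd_braiding B B (c *s u) = c *s yd_braiding B B u" for c r s u
    using linear_yd_maps by (metis linear_map_iff)+
  show ?thesis
    unfolding yd_interchange_def
    by (simp add: yd_assoc_weight[OF lin lin linear_act_tensor w(1,2) weight_vector_tensor[OF lin lin w(3,4)]]
        yd_assoc_inv_weight[OF lin lin linear_act_tensor w(1,3) weight_vector_tensor[OF lin lin w(2,4)]]
        yd_assoc_inv_weight[OF lin lin lin w(2,3,4)] yd_assoc_weight[OF lin lin lin w(3,2,4)]
        yd_braiding_weight[OF co bil y w(3)]
        tens_map_tens linear_tens_map linear_yd_maps linear_map_id tens_map_scale tens_simps mult_ac)
qed

end

section \<open>Two-dimensional Hopf algebras as Yetter-Drinfeld modules\<close>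

lemma linear_map_eq_tens:
  assumes "linear_map F" "linear_map F'" "\<And>x y. F (x \<boxtimes> y) = F' (x \<boxtimes> y)"
  shows "F t = F' t"
proof -
  have "F (axis p 1) = F' (axis p 1)" for p
    using assms(3)[of "axis (fst p) 1" "axis (snd p) 1"] by (simp add: tens_axis)
  then show ?thesis
    using linear_map_expand[OF assms(1), of t] linear_map_expand[OF assms(2), of t] by simp
qed

text \<open>
  With \<open>\<epsilon> = (a, b)\<close> in coordinates, the kernel of \<open>\<epsilon>\<close> is spanned by \<open>(b, -a)\<close>, and the coordinate
  along it is the determinant of the given vector and \<open>u\<close>.
\<close>

lemma two_dim_split:
  fixes \<epsilon> :: "'k::field ^ 'b::finite \<Rightarrow> 'k"
  assumes card: "CARD('b) = 2" and lin: "linear_form \<epsilon>" and u: "\<epsilon> u = 1"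
  obtains n d where "linear_form d" "\<epsilon> n = 0" "d n = 1" "d u = 0"
    "\<And>x. x = \<epsilon> x *s u + d x *s n"
proof -
  obtain i j :: 'b where ij: "i \<noteq> j" "UNIV = {i, j}"
    using card by (auto simp: card_2_iff)
  define a where "a = \<epsilon> (axis i 1)"
  define b where "b = \<epsilon> (axis j 1)"
  have \<epsilon>: "\<epsilon> x = x $ i * a + x $ j * b" for x
    using linear_form_eq_lin[OF lin, of x] ij(1) unfolding lin_def ij(2) a_def b_def by simp
  have cases: "P l" if "P i" "P j" for P l
    using UNIV_I[of l] that unfolding ij(2) by blast
  define n where "n = b *s axis i 1 - a *s (axis j 1 :: 'k ^ 'b)"
  define d where "d x = x $ i * u $ j - x $ j * u $ i" for x :: "'k ^ 'b"
  have n: "n $ i = b" "n $ j = - a" using ij by (auto simp: n_def axis_def)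
  have u': "u $ i * a + u $ j * b = 1" using u \<epsilon> by simp
  show thesis
  proof
    show "linear_form d" by (simp add: linear_form_iff d_def algebra_simps)
    show "\<epsilon> n = 0" by (simp add: \<epsilon> n)
    show "d n = 1" using u' by (simp add: d_def n algebra_simps)
    show "d u = 0" by (simp add: d_def)
    show "x = \<epsilon> x *s u + d x *s n" for x
    proof -
      have "x $ i = x $ i * (u $ i * a + u $ j * b)" "x $ j = x $ j * (u $ i * a + u $ j * b)"
        by (simp_all add: u')
      then show ?thesis unfolding vec_eq_iff
        by (intro allI, rule_tac l = ia in cases)
           (simp_all add: \<epsilon> n d_def algebra_simps)
    qed
  qed
qed

lemma ga_mul_axis: "ga_mul K (axis a 1) (axis b 1) = (axis (a \<otimes>\<^bsub>K\<^esub> b) 1 :: 'k::field ^ 'h)"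
proof -
  have "ga_mul K (axis a 1) (axis b 1) =
      (\<Sum>x\<in>UNIV. \<Sum>y\<in>UNIV. if y = b then if x = a then axis (x \<otimes>\<^bsub>K\<^esub> y) 1 else 0 else 0)"
    unfolding ga_mul_def by (intro sum.cong refl) (simp add: axis_def)
  then show ?thesis by simp
qed

lemma linear_ga_mul: "linear_map (ga_mul K x)" "linear_map (\<lambda>x. ga_mul K x y)"
  by (simp_all add: linear_map_iff ga_mul_def algebra_simps sum.distrib scale_sum
      vec.scale_left_distrib)

context cyclic_reassociator
begin

lemma H_simps: "hmul H = ga_mul G" "hone H = axis \<one>\<^bsub>G\<^esub> 1" "hcomul H = ga_comul" "hcounit H = lin (ch 0)"
  by (auto simp: kPhi_def Let_def ga_counit_def lin_def ch_0)

lemma linear_ga_comul: "linear_map (ga_comul :: 'k ^ 'i \<Rightarrow> 'k ^ ('i \<times> 'i))"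
  by (simp add: linear_map_iff ga_comul_def sum.distrib scale_sum vec.scale_left_distrib)

lemmas ga_linear_rules = linear_rules linear_comp[OF linear_ga_mul(1)] linear_comp[OF linear_ga_mul(2)]
  linear_comp[OF linear_ga_comul]

lemma lin_ch_one: "lin (ch i) (hone H) = 1"
  using character_ch[of i] by (simp add: H_simps lin_axis character_def)

end

text \<open>
  A Hopf algebra together with the splitting \<open>B = k 1 \<oplus> k n\<close> where \<open>n\<close> spans the kernel of the
  counit, and \<open>d\<close> is the coordinate along \<open>n\<close>.
\<close>

locale two_dim_yd_hopf = cyclic_reassociator G g m c qq q
  for G :: "'g::finite monoid" and g :: 'g and m c :: nat and qq q :: "'k::field" +
  fixes B :: "('k, 'g, 'b::finite) yd_hopf" and n :: "'k ^ 'b" and d :: "'k ^ 'b \<Rightarrow> 'k"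
  assumes hopf: "yd_hopf_algebra (kPhi G g q c) B"
    and d_linear: "linear_form d" and coun_n: "coun B n = 0" and d_n: "d n = 1"
    and d_uni: "d (uni B) = 0" and split: "\<And>x. x = coun B x *s uni B + d x *s n"
begin

lemma
  shows yd: "yd_module H B"
    and mul_hom: "yd_hom (yd_tensor H B B) B (mul B)"
    and uni_hom: "yd_hom (yd_unit H) B (\<lambda>c. c $ 1 *s uni B)"
    and comul_hom: "yd_hom B (yd_tensor H B B) (comul B)"
    and coun_hom: "yd_hom B (yd_unit H) (\<lambda>b. vec (coun B b))"
    and antip_hom: "yd_hom B B (antip B)"
    and mul_uni: "mul B (uni B \<boxtimes> b) = b" "mul B (b \<boxtimes> uni B) = b"
    and counit: "sweedler2 (comul B b) (\<lambda>b\<^sub>1 b\<^sub>2. coun B b\<^sub>1 *s b\<^sub>2) = b"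
      "sweedler2 (comul B b) (\<lambda>b\<^sub>1 b\<^sub>2. coun B b\<^sub>2 *s b\<^sub>1) = b"
    and comul_mul: "comul B (mul B t) =
      tens_map (mul B) (mul B) (yd_interchange H B B B B (tens_map (comul B) (comul B) t))"
    and comul_uni: "comul B (uni B) = uni B \<boxtimes> uni B"
    and coun_mul: "coun B (mul B (a \<boxtimes> b)) = coun B a * coun B b"
    and coun_uni: "coun B (uni B) = 1"
    and antip: "mul B (tens_map (antip B) id (comul B b)) = coun B b *s uni B"
  using hopf unfolding yd_hopf_algebra_def by (auto simp: fun_eq_iff)

lemma
  shows act_bilinear: "bilinear_map (act B)" and coact_linear: "linear_map (coact B)"
    and mul_linear: "linear_map (mul B)" and comul_linear: "linear_map (comul B)"
    and antip_linear: "linear_map (antip B)"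
    and act_linear: "linear_map (act B h)" "linear_map (\<lambda>h. act B h x)"
  using yd mul_hom comul_hom antip_hom by (auto simp: yd_module_def yd_hom_def bilinear_map_def)

lemma coun_linear: "linear_form (coun B)"
  using coun_hom by (auto simp: yd_hom_def linear_map_iff linear_form_iff vec_eq_iff)

lemma d_scale: "d (r *s x) = r * d x" and d_add: "d (x + y) = d x + d y"
  and coun_scale: "coun B (r *s x) = r * coun B x" and coun_add: "coun B (x + y) = coun B x + coun B y"
  using d_linear coun_linear by (auto simp: linear_form_iff)

lemmas form_simps = d_scale d_add coun_scale coun_add d_n d_uni coun_n coun_uni

lemma kernel_multiple: "coun B x = 0 \<Longrightarrow> x = d x *s n"
  using split[of x] by simp

subsection \<open>Action and coaction on the two basis vectors\<close>

lemma weight_uni: "weight_vector B (ch 0) (uni B)"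
  unfolding weight_vector_def
proof
  fix h
  have "(act (yd_unit H) h (vec 1)) $ 1 *s uni B = act B h ((vec 1 :: 'k ^ 1) $ 1 *s uni B)"
    using uni_hom unfolding yd_hom_def by blast
  then show "act B h (uni B) = lin (ch 0) h *s uni B" by (simp add: yd_unit_def H_simps)
qed

lemma coact_uni: "coact B (uni B) = hone H \<boxtimes> uni B"
proof -
  have "coact B ((vec 1 :: 'k ^ 1) $ 1 *s uni B) =
      sweedler2 (coact (yd_unit H) (vec 1)) (\<lambda>u y. u \<boxtimes> (y $ 1 *s uni B))"
    using uni_hom unfolding yd_hom_def by blast
  also have "\<dots> = sweedler2 (hone H \<boxtimes> (vec 1 :: 'k ^ 1)) (\<lambda>u y. u \<boxtimes> (y $ 1 *s uni B))"
    by (simp add: yd_unit_def)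
  also have "\<dots> = hone H \<boxtimes> ((vec 1 :: 'k ^ 1) $ 1 *s uni B)"
    by (rule sweedler2_tens) (intro linear_rules | simp add: linear_form_iff)+
  finally show ?thesis by simp
qed

definition weight_n :: "'g \<Rightarrow> 'k" where "weight_n a = d (act B (axis a 1) n)"

text \<open>
  The kernel of the counit is stable under the action because the counit is a morphism.
\<close>

lemma weight_n: "weight_vector B weight_n n"
  unfolding weight_vector_def
proof
  fix h
  have "vec (coun B (act B h n)) = (act (yd_unit H) h (vec (coun B n)) :: 'k ^ 1)"
    using coun_hom unfolding yd_hom_def by blast
  then have "coun B (act B h n) = 0" by (simp add: vec_eq_iff yd_unit_def coun_n)
  then have "act B h n = d (act B h n) *s n" by (rule kernel_multiple)
  also have "d (act B h n) = lin weight_n h"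
    unfolding weight_n_def
    by (rule linear_form_eq_lin)
       (use act_linear(2)[of n] in \<open>simp add: linear_form_iff linear_map_iff form_simps\<close>)
  finally show "act B h n = lin weight_n h *s n" .
qed

lemma act_n: "act B h n = lin weight_n h *s n"
  using weight_n by (simp add: weight_vector_def)

lemma character_weight_n: "character weight_n"
proof -
  have "act B (hmul H x y) n = act B x (act B y n)" "act B (hone H) n = n" for x y
    using yd by (simp_all add: yd_module_def)
  then have "d (act B (ga_mul G x y) n) = d (act B x (act B y n))" "d (act B (hone H) n) = d n" for x y
    by (simp_all add: H_simps)
  moreover have "act B x (r *s z) = r *s act B x z" for x r z
    using act_linear(1)[of x] by (simp add: linear_map_iff)
  ultimately have "lin weight_n (ga_mul G x y) = lin weight_n x * lin weight_n y"
    "lin weight_n (hone H) = 1" for x y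
    by (simp_all add: act_n form_simps mult_ac)
  note * = this(2) this(1)[of "axis a 1" "axis b 1" for a b]
  then show ?thesis by (simp add: character_def lin_axis H_simps ga_mul_axis)
qed

text \<open>
  The weight of \<open>n\<close> is a character; \<open>f\<close> is its index, so that \<open>g\<close> acts on \<open>n\<close> as \<open>q\<^sup>f\<close>.
\<close>

definition f :: nat where "f = (SOME f. f < m \<and> weight_n = ch f)"

lemma f_less: "f < m" and weight_n_ch: "weight_n = ch f"
  using someI_ex[of "\<lambda>f. f < m \<and> weight_n = ch f"] character_eq_ch[OF character_weight_n]
  by (auto simp: f_def)

lemma weight_n_f: "weight_vector B (ch f) n"
  using weight_n by (simp add: weight_n_ch)

lemma act_n_f: "act B h n = lin (ch f) h *s n"
  using weight_n_f by (simp add: weight_vector_def)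

definition v :: "'k ^ 'g" where "v = sweedler2 (coact B n) (\<lambda>u y. d y *s u)"

text \<open>
  Decompose the coaction of \<open>n\<close> as \<open>P \<otimes> 1 + Q \<otimes> n\<close>. Since the counit is a morphism of comodules and
  kills \<open>n\<close>, the part \<open>P\<close> vanishes.
\<close>

lemma coact_n: "coact B n = v \<boxtimes> n"
proof -
  define P where "P t = sweedler2 t (\<lambda>(u :: 'k ^ 'g) (y :: 'k ^ 'b). coun B y *s u)" for t
  define Q where "Q t = sweedler2 t (\<lambda>(u :: 'k ^ 'g) (y :: 'k ^ 'b). d y *s u)" for t
  have P: "P (x \<boxtimes> y) = coun B y *s x" and Q: "Q (x \<boxtimes> y) = d y *s x" for x y
    unfolding P_def Q_def by (rule sweedler2_tens, (intro linear_rules coun_linear d_linear)+)+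
  have PQ: "linear_map P" "linear_map Q" unfolding P_def Q_def by (intro linear_rules)+
  have "t = P t \<boxtimes> uni B + Q t \<boxtimes> n" for t
  proof (rule linear_map_eq_tens[where F = "\<lambda>t. t"])
    show "x \<boxtimes> y = P (x \<boxtimes> y) \<boxtimes> uni B + Q (x \<boxtimes> y) \<boxtimes> n" for x y
      using split[of y] unfolding P Q by (metis tens_add_right tens_scale_left tens_scale_right)
  qed (intro linear_rules PQ)+
  note decomp = this[of "coact B n"]
  have P1: "sweedler2 t (\<lambda>u y. u \<boxtimes> (vec (coun B y) :: 'k ^ 1)) = P t \<boxtimes> (vec 1 :: 'k ^ 1)" for t
  proof (rule linear_map_eq_tens[where F = "\<lambda>t. sweedler2 t (\<lambda>u y. u \<boxtimes> (vec (coun B y) :: 'k ^ 1))"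
        and F' = "\<lambda>t. P t \<boxtimes> (vec 1 :: 'k ^ 1)"])
    have vec: "vec (coun B y) = coun B y *s (vec 1 :: 'k ^ 1)" for y by (simp add: vec_eq_iff)
    show "sweedler2 (x \<boxtimes> y) (\<lambda>u y. u \<boxtimes> (vec (coun B y) :: 'k ^ 1)) = P (x \<boxtimes> y) \<boxtimes> (vec 1 :: 'k ^ 1)" for x y
      unfolding P vec by (subst sweedler2_tens) (intro linear_rules coun_linear | simp add: tens_simps)+
  qed (intro linear_rules PQ)+
  have "coact (yd_unit H) (vec (coun B n) :: 'k ^ 1) =
      sweedler2 (coact B n) (\<lambda>u y. u \<boxtimes> (vec (coun B y) :: 'k ^ 1))"
    using coun_hom unfolding yd_hom_def by blast
  then have "P (coact B n) \<boxtimes> (vec 1 :: 'k ^ 1) = 0"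
    by (simp add: P1 yd_unit_def coun_n) (simp add: vec_eq_iff tens_def)
  then have "P (coact B n) = 0" by (auto simp: vec_eq_iff tens_def)
  with decomp show ?thesis by (simp add: v_def Q_def) (simp add: vec_eq_iff tens_def)
qed

subsection \<open>The degree of the primitive vector\<close>

text \<open>
  The coordinates of \<open>v\<close> in the basis of idempotents.
\<close>

definition V :: "nat \<Rightarrow> 'k" where "V i = lin (ch i) v"

lemma V_mod: "V (i mod m) = V i" by (simp add: V_def ch_mod)

lemma V_0: "V 0 = 1"
proof -
  have "sweedler2 (v \<boxtimes> n) (\<lambda>u y. hcounit H u *s y) = n"
    using yd unfolding yd_module_def coact_n[symmetric] by blast
  then have "lin (ch 0) v *s n = n"
    by (subst (asm) sweedler2_tens) (auto simp: H_simps intro!: linear_rules linear_form_lin)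
  then have "d (lin (ch 0) v *s n) = d n" by simp
  then show ?thesis by (simp add: form_simps V_def)
qed

lemma lin_d: "lin (\<lambda>i. d (axis i 1)) x = d x"
  by (rule linear_form_eq_lin[OF d_linear, symmetric])

text \<open>
  The compatibility of the coaction with the comultiplication of \<open>k[G]\<close>, applied to \<open>n\<close> and tested on
  the characters \<open>i\<close> and \<open>l\<close>. On the left each of the two coactions produces a factor \<open>v\<close>; on the
  right the comultiplication of \<open>v\<close> is evaluated at two characters, that is, \<open>v\<close> at their product.
\<close>

lemma V_cocycle:
  "V i * V l * lin (tform (ch i) (tform (ch f) (ch l))) (reassoc H) =
   V (i + l) * lin (tform (ch i) (tform (ch l) (ch f))) (reassoc H) *
     lin (tform (ch f) (tform (ch i) (ch l))) (reassoc H)"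
proof -
  let ?L = "tform (ch i) (tform (ch l) (\<lambda>i. d (axis i 1)))"
  note mults = lin_character_mul[OF character_ch]
  note B_rules = ga_linear_rules linear_comp[OF coact_linear] linear_comp[OF act_linear(1)]
  have l: "sweedler2 (coact B n) (\<lambda>u y. sweedler2 (coact B (act B X\<^sub>2 y)) (\<lambda>w p.
        hmul H X\<^sub>1 u \<boxtimes> hmul H w X\<^sub>3 \<boxtimes> p)) =
      lin (ch f) X\<^sub>2 *s (ga_mul G X\<^sub>1 v \<boxtimes> ga_mul G v X\<^sub>3 \<boxtimes> n)" (is "?lhs = _") for X\<^sub>1 X\<^sub>2 X\<^sub>3
  proof -
    have "?lhs = sweedler2 (coact B (act B X\<^sub>2 n)) (\<lambda>w p. ga_mul G X\<^sub>1 v \<boxtimes> ga_mul G w X\<^sub>3 \<boxtimes> p)"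
      unfolding H_simps coact_n by (rule sweedler2_tens) (intro B_rules)+
    also have "\<dots> = lin (ch f) X\<^sub>2 *s sweedler2 (v \<boxtimes> n) (\<lambda>w p. ga_mul G X\<^sub>1 v \<boxtimes> ga_mul G w X\<^sub>3 \<boxtimes> p)"
      using coact_linear by (simp add: act_n_f linear_map_iff coact_n sweedler2_scale)
    also have "sweedler2 (v \<boxtimes> n) (\<lambda>w p. ga_mul G X\<^sub>1 v \<boxtimes> ga_mul G w X\<^sub>3 \<boxtimes> p) =
        ga_mul G X\<^sub>1 v \<boxtimes> ga_mul G v X\<^sub>3 \<boxtimes> n"
      by (rule sweedler2_tens) (intro B_rules)+
    finally show ?thesis .
  qed
  have r: "sweedler2 (coact B (act B Y\<^sub>1 n)) (\<lambda>u y. sweedler2 (hcomul H u) (\<lambda>u\<^sub>1 u\<^sub>2.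
        hmul H (hmul H X\<^sub>1 u\<^sub>1) Y\<^sub>2 \<boxtimes> hmul H (hmul H X\<^sub>2 u\<^sub>2) Y\<^sub>3 \<boxtimes> act B X\<^sub>3 y)) =
      lin (ch f) Y\<^sub>1 *s sweedler2 (ga_comul v) (\<lambda>u\<^sub>1 u\<^sub>2.
        ga_mul G (ga_mul G X\<^sub>1 u\<^sub>1) Y\<^sub>2 \<boxtimes> ga_mul G (ga_mul G X\<^sub>2 u\<^sub>2) Y\<^sub>3 \<boxtimes> (lin (ch f) X\<^sub>3 *s n))"
    (is "?lhs = _") for X\<^sub>1 X\<^sub>2 X\<^sub>3 Y\<^sub>1 Y\<^sub>2 Y\<^sub>3
  proof -
    have "?lhs = lin (ch f) Y\<^sub>1 *s sweedler2 (v \<boxtimes> n) (\<lambda>u y. sweedler2 (ga_comul u) (\<lambda>u\<^sub>1 u\<^sub>2.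
        ga_mul G (ga_mul G X\<^sub>1 u\<^sub>1) Y\<^sub>2 \<boxtimes> ga_mul G (ga_mul G X\<^sub>2 u\<^sub>2) Y\<^sub>3 \<boxtimes> act B X\<^sub>3 y))"
      using coact_linear by (simp add: H_simps act_n_f linear_map_iff coact_n sweedler2_scale)
    also have "sweedler2 (v \<boxtimes> n) (\<lambda>u y. sweedler2 (ga_comul u) (\<lambda>u\<^sub>1 u\<^sub>2.
        ga_mul G (ga_mul G X\<^sub>1 u\<^sub>1) Y\<^sub>2 \<boxtimes> ga_mul G (ga_mul G X\<^sub>2 u\<^sub>2) Y\<^sub>3 \<boxtimes> act B X\<^sub>3 y)) =
       sweedler2 (ga_comul v) (\<lambda>u\<^sub>1 u\<^sub>2.
        ga_mul G (ga_mul G X\<^sub>1 u\<^sub>1) Y\<^sub>2 \<boxtimes> ga_mul G (ga_mul G X\<^sub>2 u\<^sub>2) Y\<^sub>3 \<boxtimes> act B X\<^sub>3 n)"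
      by (rule sweedler2_tens) (intro B_rules)+
    finally show ?thesis by (simp add: act_n_f)
  qed
  have "sweedler3 (reassoc H) (\<lambda>X\<^sub>1 X\<^sub>2 X\<^sub>3. sweedler2 (coact B n) (\<lambda>u y.
            sweedler2 (coact B (act B X\<^sub>2 y)) (\<lambda>w p. hmul H X\<^sub>1 u \<boxtimes> hmul H w X\<^sub>3 \<boxtimes> p))) =
          sweedler3 (reassoc H) (\<lambda>X\<^sub>1 X\<^sub>2 X\<^sub>3. sweedler3 (reassoc H) (\<lambda>Y\<^sub>1 Y\<^sub>2 Y\<^sub>3.
            sweedler2 (coact B (act B Y\<^sub>1 n)) (\<lambda>u y. sweedler2 (hcomul H u) (\<lambda>u\<^sub>1 u\<^sub>2.
              hmul H (hmul H X\<^sub>1 u\<^sub>1) Y\<^sub>2 \<boxtimes> hmul H (hmul H X\<^sub>2 u\<^sub>2) Y\<^sub>3 \<boxtimes> act B X\<^sub>3 y))))"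
    using yd unfolding yd_module_def by blast
  then have eq: "lin ?L (sweedler3 (reassoc H) (\<lambda>X\<^sub>1 X\<^sub>2 X\<^sub>3.
        lin (ch f) X\<^sub>2 *s (ga_mul G X\<^sub>1 v \<boxtimes> ga_mul G v X\<^sub>3 \<boxtimes> n))) =
      lin ?L (sweedler3 (reassoc H) (\<lambda>X\<^sub>1 X\<^sub>2 X\<^sub>3. sweedler3 (reassoc H) (\<lambda>Y\<^sub>1 Y\<^sub>2 Y\<^sub>3.
        lin (ch f) Y\<^sub>1 *s sweedler2 (ga_comul v) (\<lambda>u\<^sub>1 u\<^sub>2.
        ga_mul G (ga_mul G X\<^sub>1 u\<^sub>1) Y\<^sub>2 \<boxtimes> ga_mul G (ga_mul G X\<^sub>2 u\<^sub>2) Y\<^sub>3 \<boxtimes> (lin (ch f) X\<^sub>3 *s n)))))"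
    unfolding l r by simp
  have "lin ?L (sweedler3 (reassoc H) (\<lambda>X\<^sub>1 X\<^sub>2 X\<^sub>3.
        lin (ch f) X\<^sub>2 *s (ga_mul G X\<^sub>1 v \<boxtimes> ga_mul G v X\<^sub>3 \<boxtimes> n))) =
      lin (tform (ch i) (tform (ch f) (ch l))) (reassoc H) * (V i * V l)"
    by (rule lin_sweedler3)
       (simp add: lin_scale lin_tform_tens mults lin_axis lin_d d_n V_def mult_ac)
  moreover have "lin ?L (sweedler3 (reassoc H) (\<lambda>X\<^sub>1 X\<^sub>2 X\<^sub>3. sweedler3 (reassoc H) (\<lambda>Y\<^sub>1 Y\<^sub>2 Y\<^sub>3.
        lin (ch f) Y\<^sub>1 *s sweedler2 (ga_comul v) (\<lambda>u\<^sub>1 u\<^sub>2.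
        ga_mul G (ga_mul G X\<^sub>1 u\<^sub>1) Y\<^sub>2 \<boxtimes> ga_mul G (ga_mul G X\<^sub>2 u\<^sub>2) Y\<^sub>3 \<boxtimes> (lin (ch f) X\<^sub>3 *s n))))) =
      lin (tform (ch i) (tform (ch l) (ch f))) (reassoc H) *
        (lin (tform (ch f) (tform (ch i) (ch l))) (reassoc H) * V (i + l))"
  proof (rule lin_sweedler3)
    fix a b e
    have "lin ?L (sweedler2 (ga_comul v) (\<lambda>u\<^sub>1 u\<^sub>2. ga_mul G (ga_mul G (axis a 1) u\<^sub>1) Y\<^sub>2 \<boxtimes>
        ga_mul G (ga_mul G (axis b 1) u\<^sub>2) Y\<^sub>3 \<boxtimes> (lin (ch f) (axis e 1) *s n))) =
      lin (tform (ch i) (ch l)) (ga_comul v) *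
        (ch i a * ch l b * ch f e * lin (ch i) Y\<^sub>2 * lin (ch l) Y\<^sub>3)" for Y\<^sub>2 Y\<^sub>3
      by (rule lin_sweedler2)
         (simp add: lin_scale lin_tform_tens mults lin_axis lin_d form_simps mult_ac)
    note inner = this[unfolded lin_comul ch_mult lin_axis, folded V_def]
    show "lin ?L (sweedler3 (reassoc H) (\<lambda>Y\<^sub>1 Y\<^sub>2 Y\<^sub>3.
        lin (ch f) Y\<^sub>1 *s sweedler2 (ga_comul v) (\<lambda>u\<^sub>1 u\<^sub>2.
        ga_mul G (ga_mul G (axis a 1) u\<^sub>1) Y\<^sub>2 \<boxtimes> ga_mul G (ga_mul G (axis b 1) u\<^sub>2) Y\<^sub>3 \<boxtimes>
        (lin (ch f) (axis e 1) *s n)))) =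
      ch i a * ch l b * ch f e * (lin (tform (ch f) (tform (ch i) (ch l))) (reassoc H) * V (i + l))"
      by (subst lin_sweedler3[where \<phi> = "ch f" and \<psi> = "ch i" and \<theta> = "ch l" and
            \<kappa> = "ch i a * ch l b * ch f e * V (i + l)"])
         (simp_all only: lin_scale inner lin_axis mult_ac)
  qed
  ultimately show ?thesis using eq by (simp add: mult_ac)
qed

text \<open>
  The two values of the reassociator with \<open>i\<close> in the first place are equal because \<open>\<Phi>\<close> is symmetric
  in its last two arguments, so they cancel. What remains says that \<open>v\<close> is group-like up to the
  carry in the addition of residues.
\<close>

lemma V_mult: "V i * V l = q ^ (c * f * ((i mod m + l mod m) div m)) * V (i + l)"
proof -
  have "lin (tform (ch i) (tform (ch f) (ch l))) (reassoc H) =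
      lin (tform (ch i) (tform (ch l) (ch f))) (reassoc H)"
    by (simp add: reassoc_ch add.commute)
  moreover have "lin (tform (ch i) (tform (ch f) (ch l))) (reassoc H) \<noteq> 0"
    using q_nz by (simp add: reassoc_ch)
  ultimately show ?thesis using V_cocycle[of i l] f_less
    by (simp add: reassoc_ch q_nz mult_ac)
qed

lemma V_power: "j < m \<Longrightarrow> V j = V 1 ^ j"
proof (induction j)
  case (Suc j)
  then show ?case using V_mult[of 1 j] m2 by simp
qed (simp add: V_0)

text \<open>
  The only carry met on the way from \<open>V 1\<close> to \<open>V m = V 0 = 1\<close> occurs in the last step.
\<close>

lemma V_1_power_m: "V 1 ^ m = q ^ (c * f)"
proof -
  have "V 1 * V (m - 1) = q ^ (c * f)"
    using V_mult[of 1 "m - 1"] V_mod[of m] V_0 m2 by simp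
  then show ?thesis using V_power[of "m - 1"] m2 by (simp flip: power_Suc)
qed

end

section \<open>Product, coproduct and antipode in dimension two\<close>

context two_dim_yd_hopf
begin

text \<open>
  The product and coproduct of \<open>n\<close> leave one unknown scalar each: \<open>n\<^sup>2 = lam n\<close> because \<open>n\<^sup>2\<close> lies in
  the kernel of the counit, and \<open>\<Delta>(n) = n \<otimes> 1 + 1 \<otimes> n + mu n \<otimes> n\<close> by the counit axioms.
\<close>

definition lam :: 'k where "lam = d (mul B (n \<boxtimes> n))"

lemma mul_nn: "mul B (n \<boxtimes> n) = lam *s n"
  unfolding lam_def by (rule kernel_multiple) (simp add: coun_mul coun_n)

definition mu :: 'k where
  "mu = lin (tform (\<lambda>i. d (axis i 1)) (\<lambda>i. d (axis i 1))) (comul B n)"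

lemma lin_coun: "lin (\<lambda>i. coun B (axis i 1)) x = coun B x"
  by (rule linear_form_eq_lin[OF coun_linear, symmetric])

lemma comul_n: "comul B n = n \<boxtimes> uni B + uni B \<boxtimes> n + mu *s (n \<boxtimes> n)"
proof -
  let ?e = "\<lambda>i. coun B (axis i 1)" and ?d = "\<lambda>i. d (axis i 1)"
  have decomp: "t = lin (tform ?e ?e) t *s (uni B \<boxtimes> uni B) + lin (tform ?e ?d) t *s (uni B \<boxtimes> n) +
      lin (tform ?d ?e) t *s (n \<boxtimes> uni B) + lin (tform ?d ?d) t *s (n \<boxtimes> n)" for t
  proof (rule linear_map_eq_tens[where F = "\<lambda>t. t"])
    fix x y
    have "x \<boxtimes> y = (coun B x *s uni B + d x *s n) \<boxtimes> (coun B y *s uni B + d y *s n)"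
      using split[of x] split[of y] by simp
    also have "\<dots> = (coun B x * coun B y) *s (uni B \<boxtimes> uni B) + (coun B x * d y) *s (uni B \<boxtimes> n) +
        (d x * coun B y) *s (n \<boxtimes> uni B) + (d x * d y) *s (n \<boxtimes> n)"
      by (simp add: tens_simps vec.scale_right_distrib mult_ac add_ac)
    finally show "x \<boxtimes> y = lin (tform ?e ?e) (x \<boxtimes> y) *s (uni B \<boxtimes> uni B) +
        lin (tform ?e ?d) (x \<boxtimes> y) *s (uni B \<boxtimes> n) +
        lin (tform ?d ?e) (x \<boxtimes> y) *s (n \<boxtimes> uni B) + lin (tform ?d ?d) (x \<boxtimes> y) *s (n \<boxtimes> n)"
      unfolding lin_tform_tens lin_d lin_coun .
  qed (intro linear_rules linear_form_lin)+
  have ee: "lin (tform ?e ?e) (comul B n) = 0"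
    using lin_sweedler2[of ?e "\<lambda>x y. coun B x *s y" ?e ?e 1 "comul B n"]
    by (simp add: counit lin_coun lin_scale coun_n form_simps)
  have ed: "lin (tform ?e ?d) (comul B n) = 1"
    using lin_sweedler2[of ?d "\<lambda>x y. coun B x *s y" ?e ?d 1 "comul B n"]
    by (simp add: counit lin_d lin_scale d_n form_simps)
  have de: "lin (tform ?d ?e) (comul B n) = 1"
    using lin_sweedler2[of ?d "\<lambda>x y. coun B y *s x" ?d ?e 1 "comul B n"]
    by (simp add: counit lin_d lin_scale d_n form_simps)
  show ?thesis using decomp[of "comul B n"] by (simp add: ee ed de mu_def add_ac)
qed

subsection \<open>A non-zero square or coproduct correction forces trivial weight\<close>

text \<open>
  Any non-zero equivariant map between \<open>n\<close> and \<open>n \<otimes> n\<close>, in either direction, identifies the weight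
  \<open>f\<close> with \<open>2 f\<close>. The scalar \<open>r\<close> will be \<open>lam\<close> or \<open>mu\<close>.
\<close>

lemma f_eq_0:
  assumes "r \<noteq> 0" "\<And>a. r * ch f a = r * (ch f a * ch f a)"
  shows "f = 0"
proof -
  have "r * q ^ f = r * (q ^ f * q ^ f)"
    using assms(2)[of "pw 1"] unfolding ch_pw by simp
  then have "q ^ f = 1" using assms(1) q_nz by simp
  then have "m dvd f" using primitive_root_power_eq_1_iff[OF q_prim] by blast
  then show ?thesis using f_less by (auto dest: dvd_imp_le)
qed

lemma act_tensor_nn: "act (yd_tensor H B B) h (n \<boxtimes> n) = lin (\<lambda>a. ch f a * ch f a) h *s (n \<boxtimes> n)"
  using weight_vector_tensor[OF act_linear(1) act_linear(1) weight_n_f weight_n_f]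
  by (simp add: weight_vector_def)

lemma lam_f: "lam \<noteq> 0 \<Longrightarrow> f = 0"
proof (erule f_eq_0)
  fix a
  have "mul B (act (yd_tensor H B B) (axis a 1) (n \<boxtimes> n)) = act B (axis a 1) (mul B (n \<boxtimes> n))"
    using mul_hom unfolding yd_hom_def by blast
  then have "d (mul B (act (yd_tensor H B B) (axis a 1) (n \<boxtimes> n))) = d (act B (axis a 1) (mul B (n \<boxtimes> n)))"
    by simp
  then show "lam * ch f a = lam * (ch f a * ch f a)"
    using mul_linear act_linear(1)
    by (simp add: act_tensor_nn linear_map_iff mul_nn act_n_f lin_axis form_simps mult_ac)
qed

lemma mu_f: "mu \<noteq> 0 \<Longrightarrow> f = 0"
proof (erule f_eq_0)
  fix a
  let ?L = "lin (tform (\<lambda>i. d (axis i 1)) (\<lambda>i. d (axis i 1)))"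
  let ?A = "act (yd_tensor H B B) (axis a 1)"
  have "comul B (act B (axis a 1) n) = ?A (comul B n)"
    using comul_hom unfolding yd_hom_def by blast
  then have "?L (comul B (act B (axis a 1) n)) = ?L (?A (comul B n))" by simp
  moreover have "?A (n \<boxtimes> uni B) = (ch f a * ch 0 a) *s (n \<boxtimes> uni B)"
    "?A (uni B \<boxtimes> n) = (ch 0 a * ch f a) *s (uni B \<boxtimes> n)"
    using weight_vector_tensor[OF act_linear(1) act_linear(1) weight_n_f weight_uni]
      weight_vector_tensor[OF act_linear(1) act_linear(1) weight_uni weight_n_f]
    by (simp_all add: weight_vector_def lin_axis)
  moreover have "?A (s + t) = ?A s + ?A t" "?A (r *s t) = r *s ?A t" for s t r
    using linear_act_tensor[of H B B "axis a 1"] by (simp_all add: linear_map_iff)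
  ultimately show "mu * ch f a = mu * (ch f a * ch f a)"
    using comul_linear
    by (simp add: act_n_f lin_axis linear_map_iff comul_n act_tensor_nn lin_add lin_scale
        lin_tform_tens lin_d form_simps mult_ac)
qed

text \<open>
  For trivial weight the coaction of \<open>n \<otimes> n\<close> is \<open>v\<^sup>2 \<otimes> (n \<otimes> n)\<close>: every reassociator in the formula
  for the tensor product is evaluated at a trivial character. As the product is a comodule map,
  \<open>lam v = lam v\<^sup>2\<close>, here read on the character \<open>i\<close>.
\<close>

lemma lam_V:
  assumes "f = 0"
  shows "lam * V i = lam * (V i * V i)"
proof -
  let ?d = "\<lambda>i. d (axis i 1)"
  define D where "D p = d (mul B (axis p 1))" for p
  have "linear_form (\<lambda>t. d (mul B t))"
    using mul_linear by (simp add: linear_form_iff linear_map_iff form_simps)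
  then have lin_D: "lin D t = d (mul B t)" for t
    unfolding D_def by (rule linear_form_eq_lin[symmetric])
  have act: "act B h n = lin (ch 0) h *s n" for h using act_n_f assms by simp
  note mults = lin_character_mul[OF character_ch]
  note B_rules = ga_linear_rules linear_comp[OF coact_linear] linear_comp[OF act_linear(1)]
  have co: "coact B (mul B (n \<boxtimes> n)) = sweedler2 (coact (yd_tensor H B B) (n \<boxtimes> n)) (\<lambda>u y. u \<boxtimes> mul B y)"
    using mul_hom unfolding yd_hom_def by blast
  have "lin (tform (ch i) ?d) (coact B (mul B (n \<boxtimes> n))) = lam * V i"
    using coact_linear by (simp add: mul_nn linear_map_iff coact_n lin_scale lin_tform_tens lin_d d_n V_def)
  moreover have "lin (tform (ch i) ?d) (sweedler2 (coact (yd_tensor H B B) (n \<boxtimes> n)) (\<lambda>u y. u \<boxtimes> mul B y))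
    = lin (tform (ch i) D) (coact (yd_tensor H B B) (n \<boxtimes> n))"
    using lin_sweedler2[of "tform (ch i) ?d" "\<lambda>u y. u \<boxtimes> mul B y" "ch i" D 1
        "coact (yd_tensor H B B) (n \<boxtimes> n)"]
    by (simp add: lin_tform_tens lin_axis lin_d D_def)
  moreover have "lin (tform (ch i) D) (coact (yd_tensor H B B) (n \<boxtimes> n)) = V i * V i * lam"
  proof -
    have inner: "sweedler2 (coact B (act B (hmul H x\<^sub>1 Y\<^sub>1) n)) (\<lambda>u m'.
           sweedler2 (coact B (act B Y\<^sub>2 n)) (\<lambda>w n'.
           hmul H (hmul H (hmul H (hmul H X\<^sub>1 u) x\<^sub>2) w) Y\<^sub>3 \<boxtimes>
             act B X\<^sub>2 m' \<boxtimes> act B (hmul H X\<^sub>3 x\<^sub>3) n')) =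
        (lin (ch 0) x\<^sub>1 * lin (ch 0) Y\<^sub>1 * lin (ch 0) Y\<^sub>2 * lin (ch 0) X\<^sub>2 * lin (ch 0) X\<^sub>3 * lin (ch 0) x\<^sub>3) *s
         (ga_mul G (ga_mul G (ga_mul G (ga_mul G X\<^sub>1 v) x\<^sub>2) v) Y\<^sub>3 \<boxtimes> n \<boxtimes> n)" (is "?lhs = _")
      for x\<^sub>1 x\<^sub>2 x\<^sub>3 X\<^sub>1 X\<^sub>2 X\<^sub>3 Y\<^sub>1 Y\<^sub>2 Y\<^sub>3
    proof -
      have c: "coact B (r *s n) = r *s (v \<boxtimes> n)" for r
        using coact_linear by (simp add: linear_map_iff coact_n)
      have in2: "sweedler2 (v \<boxtimes> n) (\<lambda>w n'. ga_mul G (ga_mul G (ga_mul G (ga_mul G X\<^sub>1 u) x\<^sub>2) w) Y\<^sub>3 \<boxtimes>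
             act B X\<^sub>2 m' \<boxtimes> act B (ga_mul G X\<^sub>3 x\<^sub>3) n') =
          ga_mul G (ga_mul G (ga_mul G (ga_mul G X\<^sub>1 u) x\<^sub>2) v) Y\<^sub>3 \<boxtimes> act B X\<^sub>2 m' \<boxtimes> act B (ga_mul G X\<^sub>3 x\<^sub>3) n"
        for u m' by (rule sweedler2_tens) (intro B_rules)+
      have "?lhs = lin (ch 0) (ga_mul G x\<^sub>1 Y\<^sub>1) *s sweedler2 (v \<boxtimes> n) (\<lambda>u m'. lin (ch 0) Y\<^sub>2 *s
          (ga_mul G (ga_mul G (ga_mul G (ga_mul G X\<^sub>1 u) x\<^sub>2) v) Y\<^sub>3 \<boxtimes> act B X\<^sub>2 m' \<boxtimes> act B (ga_mul G X\<^sub>3 x\<^sub>3) n))"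
        unfolding H_simps act[of Y\<^sub>2] act[of "ga_mul G x\<^sub>1 Y\<^sub>1"] c sweedler2_scale in2 ..
      also have "sweedler2 (v \<boxtimes> n) (\<lambda>u m'. lin (ch 0) Y\<^sub>2 *s
          (ga_mul G (ga_mul G (ga_mul G (ga_mul G X\<^sub>1 u) x\<^sub>2) v) Y\<^sub>3 \<boxtimes> act B X\<^sub>2 m' \<boxtimes> act B (ga_mul G X\<^sub>3 x\<^sub>3) n)) =
          lin (ch 0) Y\<^sub>2 *s
          (ga_mul G (ga_mul G (ga_mul G (ga_mul G X\<^sub>1 v) x\<^sub>2) v) Y\<^sub>3 \<boxtimes> act B X\<^sub>2 n \<boxtimes> act B (ga_mul G X\<^sub>3 x\<^sub>3) n)"
        by (rule sweedler2_tens) (intro B_rules)+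
      finally show ?thesis by (simp add: act tens_simps mults mult_ac)
    qed
    let ?body = "\<lambda>m n. sweedler3 (reassoc H) (\<lambda>X\<^sub>1 X\<^sub>2 X\<^sub>3. sweedler3 (reassoc_inv H) (\<lambda>x\<^sub>1 x\<^sub>2 x\<^sub>3.
       sweedler3 (reassoc H) (\<lambda>Y\<^sub>1 Y\<^sub>2 Y\<^sub>3.
         sweedler2 (coact B (act B (hmul H x\<^sub>1 Y\<^sub>1) m)) (\<lambda>u m'.
         sweedler2 (coact B (act B Y\<^sub>2 n)) (\<lambda>w n'.
           hmul H (hmul H (hmul H (hmul H X\<^sub>1 u) x\<^sub>2) w) Y\<^sub>3 \<boxtimes>
             act B X\<^sub>2 m' \<boxtimes> act B (hmul H X\<^sub>3 x\<^sub>3) n')))))"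
    have "coact (yd_tensor H B B) (n \<boxtimes> n) = sweedler2 (n \<boxtimes> n) ?body"
      by (simp add: yd_tensor_def)
    also have "\<dots> = ?body n n"
      by (rule sweedler2_tens) (unfold H_simps, (intro B_rules)+)
    finally have eq: "coact (yd_tensor H B B) (n \<boxtimes> n) =
      sweedler3 (reassoc H) (\<lambda>X\<^sub>1 X\<^sub>2 X\<^sub>3. sweedler3 (reassoc_inv H) (\<lambda>x\<^sub>1 x\<^sub>2 x\<^sub>3.
       sweedler3 (reassoc H) (\<lambda>Y\<^sub>1 Y\<^sub>2 Y\<^sub>3.
        (lin (ch 0) x\<^sub>1 * lin (ch 0) Y\<^sub>1 * lin (ch 0) Y\<^sub>2 * lin (ch 0) X\<^sub>2 * lin (ch 0) X\<^sub>3 * lin (ch 0) x\<^sub>3) *s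
         (ga_mul G (ga_mul G (ga_mul G (ga_mul G X\<^sub>1 v) x\<^sub>2) v) Y\<^sub>3 \<boxtimes> n \<boxtimes> n))))"
      unfolding inner .
    let ?L = "tform (ch i) D"
    have Dn: "lin D (n \<boxtimes> n) = lam" by (simp add: lin_D lam_def)
    \<comment> \<open>The three sums are evaluated from the outside in; the scalars of the outer ones are constants for the inner ones.\<close>
    have "lin ?L (coact (yd_tensor H B B) (n \<boxtimes> n)) =
      lin (tform (ch i) (tform (ch 0) (ch 0))) (reassoc H) *
      (lin (tform (ch 0) (tform (ch i) (ch 0))) (reassoc_inv H) *
      (lin (tform (ch 0) (tform (ch 0) (ch i))) (reassoc H) * (V i * V i * lam)))"
      unfolding eq
    proof (rule lin_sweedler3)
      fix X\<^sub>1 X\<^sub>2 X\<^sub>3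
      have "lin ?L (sweedler3 (reassoc_inv H) (\<lambda>x\<^sub>1 x\<^sub>2 x\<^sub>3. sweedler3 (reassoc H) (\<lambda>Y\<^sub>1 Y\<^sub>2 Y\<^sub>3.
        (lin (ch 0) x\<^sub>1 * lin (ch 0) Y\<^sub>1 * lin (ch 0) Y\<^sub>2 * lin (ch 0) (axis X\<^sub>2 1) * lin (ch 0) (axis X\<^sub>3 1) * lin (ch 0) x\<^sub>3) *s
         (ga_mul G (ga_mul G (ga_mul G (ga_mul G (axis X\<^sub>1 1) v) x\<^sub>2) v) Y\<^sub>3 \<boxtimes> n \<boxtimes> n)))) =
       lin (tform (ch 0) (tform (ch i) (ch 0))) (reassoc_inv H) *
       (ch i X\<^sub>1 * ch 0 X\<^sub>2 * ch 0 X\<^sub>3 *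
      (lin (tform (ch 0) (tform (ch 0) (ch i))) (reassoc H) * (V i * V i * lam)))"
      proof (rule lin_sweedler3)
        fix x\<^sub>1 x\<^sub>2 x\<^sub>3
        have "lin ?L (sweedler3 (reassoc H) (\<lambda>Y\<^sub>1 Y\<^sub>2 Y\<^sub>3.
          (lin (ch 0) (axis x\<^sub>1 1) * lin (ch 0) Y\<^sub>1 * lin (ch 0) Y\<^sub>2 * lin (ch 0) (axis X\<^sub>2 1) * lin (ch 0) (axis X\<^sub>3 1) * lin (ch 0) (axis x\<^sub>3 1)) *s
           (ga_mul G (ga_mul G (ga_mul G (ga_mul G (axis X\<^sub>1 1) v) (axis x\<^sub>2 1)) v) Y\<^sub>3 \<boxtimes> n \<boxtimes> n))) =
         lin (tform (ch 0) (tform (ch 0) (ch i))) (reassoc H) *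
         (ch i X\<^sub>1 * ch 0 X\<^sub>2 * ch 0 X\<^sub>3 * (ch 0 x\<^sub>1 * ch i x\<^sub>2 * ch 0 x\<^sub>3) * (V i * V i * lam))"
          by (rule lin_sweedler3)
             (simp only: lin_scale lin_tform_tens mults lin_axis Dn V_def mult_ac)
        then show "lin ?L (sweedler3 (reassoc H) (\<lambda>Y\<^sub>1 Y\<^sub>2 Y\<^sub>3.
          (lin (ch 0) (axis x\<^sub>1 1) * lin (ch 0) Y\<^sub>1 * lin (ch 0) Y\<^sub>2 * lin (ch 0) (axis X\<^sub>2 1) * lin (ch 0) (axis X\<^sub>3 1) * lin (ch 0) (axis x\<^sub>3 1)) *s
           (ga_mul G (ga_mul G (ga_mul G (ga_mul G (axis X\<^sub>1 1) v) (axis x\<^sub>2 1)) v) Y\<^sub>3 \<boxtimes> n \<boxtimes> n))) =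
           ch 0 x\<^sub>1 * ch i x\<^sub>2 * ch 0 x\<^sub>3 * (ch i X\<^sub>1 * ch 0 X\<^sub>2 * ch 0 X\<^sub>3 *
             (lin (tform (ch 0) (tform (ch 0) (ch i))) (reassoc H) * (V i * V i * lam)))"
          by (simp only: mult_ac)
      qed
      then show "lin ?L (sweedler3 (reassoc_inv H) (\<lambda>x\<^sub>1 x\<^sub>2 x\<^sub>3. sweedler3 (reassoc H) (\<lambda>Y\<^sub>1 Y\<^sub>2 Y\<^sub>3.
        (lin (ch 0) x\<^sub>1 * lin (ch 0) Y\<^sub>1 * lin (ch 0) Y\<^sub>2 * lin (ch 0) (axis X\<^sub>2 1) * lin (ch 0) (axis X\<^sub>3 1) * lin (ch 0) x\<^sub>3) *s
         (ga_mul G (ga_mul G (ga_mul G (ga_mul G (axis X\<^sub>1 1) v) x\<^sub>2) v) Y\<^sub>3 \<boxtimes> n \<boxtimes> n)))) =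
        ch i X\<^sub>1 * ch 0 X\<^sub>2 * ch 0 X\<^sub>3 *
        (lin (tform (ch 0) (tform (ch i) (ch 0))) (reassoc_inv H) *
        (lin (tform (ch 0) (tform (ch 0) (ch i))) (reassoc H) * (V i * V i * lam)))"
        by (simp only: mult_ac)
    qed
    then show ?thesis by (simp add: reassoc_normalised)
  qed
  ultimately show ?thesis using co by (simp add: mult_ac)
qed

text \<open>
  The value \<open>V 1\<close> is idempotent by \<open>lam_V\<close> and invertible by \<open>V_1_power_m\<close>, hence \<open>1\<close>.
\<close>

lemma v_trivial:
  assumes "lam \<noteq> 0" shows "v = hone H"
proof (rule ch_separate)
  fix j assume j: "j < m"
  have f: "f = 0" by (rule lam_f) fact
  have "V 1 ^ m = 1" using V_1_power_m f by simp
  then have "V 1 \<noteq> 0" using m2 by (auto simp: power_0_left)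
  moreover have "V 1 = V 1 * V 1" using lam_V[OF f, of 1] assms by simp
  ultimately have "V 1 = 1" by simp
  then show "lin (ch j) v = lin (ch j) (hone H)"
    using V_power[OF j] by (simp add: V_def lin_ch_one)
qed

subsection \<open>Compatibility of product and coproduct\<close>

lemma compat_term:
  assumes "weight_vector B (ch i1) x" "weight_vector B (ch i2) y" "weight_vector B (ch i3) z"
    "weight_vector B (ch i4) t" "coact B y = w \<boxtimes> y"
  shows "lin (tform (\<lambda>i. d (axis i 1)) (\<lambda>i. d (axis i 1)))
      (tens_map (mul B) (mul B) (yd_interchange H B B B B ((x \<boxtimes> y) \<boxtimes> (z \<boxtimes> t)))) =
    (lin (tform (ch i1) (tform (ch i2) (ch (i3 + i4)))) (reassoc H) *
     lin (tform (ch i2) (tform (ch i3) (ch i4))) (reassoc_inv H) * lin (ch i3) w *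
     lin (tform (ch i3) (tform (ch i2) (ch i4))) (reassoc H) *
     lin (tform (ch i1) (tform (ch i3) (ch (i2 + i4)))) (reassoc_inv H)) *
     (d (mul B (x \<boxtimes> z)) * d (mul B (y \<boxtimes> t)))"
  unfolding yd_interchange_weight[OF yd assms] ch_mult
  by (simp add: tens_map_scale tens_map_tens mul_linear lin_scale lin_tform_tens lin_d)

text \<open>
  The coefficient of \<open>n \<otimes> n\<close> in \<open>\<Delta>(n\<^sup>2) = \<Delta>(n) \<Delta>(n)\<close>. Of the nine products of terms on the right,
  \<open>(n \<otimes> 1)(1 \<otimes> n)\<close> contributes \<open>1\<close> and \<open>(1 \<otimes> n)(n \<otimes> 1)\<close> contributes the braiding scalar
  \<open>\<sigma>(v) = V f\<close>, the reassociators being evaluated at a trivial character. The other two products with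
  two factors \<open>n\<close> have no component along \<open>n \<otimes> n\<close>. Products with three or four factors \<open>n\<close> involve \<open>n\<^sup>2\<close>, so they contribute only if \<open>lam\<close> is non-zero, in which case the
  weight is trivial and all scalars are \<open>1\<close>.
\<close>

lemma compat_nn:
  "lam * mu = 1 + V f + (if f = 0 then 4 * (lam * mu) + lam * lam * mu * mu else 0)"
proof -
  let ?L = "\<lambda>t. lin (tform (\<lambda>i. d (axis i 1)) (\<lambda>i. d (axis i 1)))
      (tens_map (mul B) (mul B) (yd_interchange H B B B B t))"
  have L: "?L (s + t) = ?L s + ?L t" "?L (r *s t) = r * ?L t" for s t r
    using yd_interchange_linear[of H B B B B]
    by (simp_all add: linear_map_iff tens_map_add tens_map_scale lin_add lin_scale)
  note wts = weight_n_f weight_uni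
  have terms:
    "?L ((n \<boxtimes> uni B) \<boxtimes> (n \<boxtimes> uni B)) = 0"
    "?L ((uni B \<boxtimes> n) \<boxtimes> (uni B \<boxtimes> n)) = 0"
    "?L ((n \<boxtimes> uni B) \<boxtimes> (uni B \<boxtimes> n)) = 1"
    "?L ((uni B \<boxtimes> n) \<boxtimes> (n \<boxtimes> uni B)) = V f"
    by (simp_all add: compat_term[OF wts(1,2,1,2) coact_uni] compat_term[OF wts(2,1,2,1) coact_n]
        compat_term[OF wts(1,2,2,1) coact_uni] compat_term[OF wts(2,1,1,2) coact_n]
        mul_uni mul_nn form_simps reassoc_normalised lin_ch_one V_def)
  have lam_terms:
    "?L ((n \<boxtimes> uni B) \<boxtimes> (n \<boxtimes> n)) = (if f = 0 then lam else 0)"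
    "?L ((uni B \<boxtimes> n) \<boxtimes> (n \<boxtimes> n)) = (if f = 0 then lam else 0)"
    "?L ((n \<boxtimes> n) \<boxtimes> (n \<boxtimes> uni B)) = (if f = 0 then lam else 0)"
    "?L ((n \<boxtimes> n) \<boxtimes> (uni B \<boxtimes> n)) = (if f = 0 then lam else 0)"
    "?L ((n \<boxtimes> n) \<boxtimes> (n \<boxtimes> n)) = (if f = 0 then lam * lam else 0)"
    using lam_f V_0
    by (auto simp add: compat_term[OF wts(1,2,1,1) coact_uni] compat_term[OF wts(2,1,1,1) coact_n]
        compat_term[OF wts(1,1,1,2) coact_n] compat_term[OF wts(1,1,2,1) coact_n]
        compat_term[OF wts(1,1,1,1) coact_n]
        mul_uni mul_nn form_simps reassoc_normalised lin_ch_one V_def[symmetric])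
  have "comul B (mul B (n \<boxtimes> n)) = tens_map (mul B) (mul B) (yd_interchange H B B B B
      (comul B n \<boxtimes> comul B n))"
    unfolding comul_mul by (simp add: tens_map_tens comul_linear)
  then have "lin (tform (\<lambda>i. d (axis i 1)) (\<lambda>i. d (axis i 1))) (comul B (mul B (n \<boxtimes> n))) =
      ?L (comul B n \<boxtimes> comul B n)" by simp
  moreover have "lin (tform (\<lambda>i. d (axis i 1)) (\<lambda>i. d (axis i 1))) (comul B (mul B (n \<boxtimes> n))) = lam * mu"
    using comul_linear by (simp add: mul_nn linear_map_iff lin_scale mu_def)
  moreover have "?L (comul B n \<boxtimes> comul B n) =
      1 + V f + (if f = 0 then 4 * (lam * mu) + lam * lam * mu * mu else 0)"
    unfolding comul_n tens_simps L terms lam_terms by (simp add: algebra_simps)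
  ultimately show ?thesis by simp
qed

subsection \<open>The antipode\<close>

lemma mul_simps: "mul B (s + t) = mul B s + mul B t" "mul B (r *s t) = r *s mul B t"
  using mul_linear by (simp_all add: linear_map_iff)

lemma antip_uni: "antip B (uni B) = uni B"
proof -
  have "mul B (tens_map (antip B) id (uni B \<boxtimes> uni B)) = uni B"
    using antip[of "uni B"] by (simp add: comul_uni coun_uni)
  then show ?thesis
    by (simp add: tens_map_tens antip_linear linear_map_id mul_uni)
qed

lemma antip_n:
  obtains s where "antip B n = s *s n" "s + 1 + s * (lam * mu) = 0"
proof -
  have "mul B (tens_map (antip B) id (comul B n)) = 0"
    using antip[of n] by (simp add: coun_n)
  then have eq: "antip B n + n + mu *s mul B (antip B n \<boxtimes> n) = 0"
    by (simp add: comul_n tens_map_add tens_map_scale tens_map_tens antip_linear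
        linear_map_id mul_uni antip_uni mul_simps)
  then have "coun B (antip B n + n + mu *s mul B (antip B n \<boxtimes> n)) = coun B 0" by simp
  then have "coun B (antip B n) = 0"
    by (simp add: form_simps coun_mul linear_form_0[OF coun_linear])
  then have S: "antip B n = d (antip B n) *s n" by (rule kernel_multiple)
  have "antip B n \<boxtimes> n = d (antip B n) *s (n \<boxtimes> n)"
    using arg_cong[OF S, of "\<lambda>x. x \<boxtimes> n"] by (simp only: tens_scale_left)
  then have "mul B (antip B n \<boxtimes> n) = (d (antip B n) * lam) *s n"
    by (simp add: mul_simps mul_nn)
  moreover have "d (antip B n + n + mu *s mul B (antip B n \<boxtimes> n)) = d 0" using eq by simp
  ultimately have "d (antip B n) + 1 + d (antip B n) * (lam * mu) = 0"
    by (simp add: form_simps linear_form_0[OF d_linear] mult_ac)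
  with S show thesis by (rule that)
qed

end

section \<open>Recognising the two isomorphism types\<close>

lemma two_eq_zero_mod_2: "(2 :: 2) = 0" by simp

lemma mult_C2: "a \<otimes>\<^bsub>C2\<^esub> b = a + b" and one_C2: "\<one>\<^bsub>C2\<^esub> = 0"
  by (simp_all add: C2_def)

lemma two_cases: "a = 0 \<or> a = (1 :: 2)"
  using exhaust_2[of a] by auto

lemma inv_C2: "inv\<^bsub>C2\<^esub> a = (a :: 2)"
  unfolding m_inv_def mult_C2 one_C2
proof (rule the_equality)
  show "a \<in> carrier C2 \<and> a + a = 0 \<and> a + a = 0"
    using two_cases[of a] by (auto simp: C2_def)
  show "y = a" if "y \<in> carrier C2 \<and> a + y = 0 \<and> y + a = 0" for y
    using that two_cases[of a] two_cases[of y] by auto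
qed

lemma ga_comul_axis: "ga_comul (axis a 1) = (axis a 1 :: 'k::field ^ 'i) \<boxtimes> axis a 1"
  by (simp add: ga_comul_def axis_def if_distrib if_distribR cong: if_cong)

lemma ga_antipode_C2: "ga_antipode C2 x = x"
  by (simp add: ga_antipode_def inv_C2 vec_expand)

context two_dim_yd_hopf
begin

lemma linear_map_eq_basis:
  assumes "linear_map F" "linear_map F'" "F (uni B) = F' (uni B)" "F n = F' n"
  shows "F x = F' x"
proof -
  have "F (coun B x *s uni B + d x *s n) = F' (coun B x *s uni B + d x *s n)"
    using assms by (simp add: linear_map_iff)
  then show ?thesis using split[of x] by simp
qed

lemma linear_map_eq_basis2:
  assumes F: "linear_map F" "linear_map F'" and "F (uni B \<boxtimes> uni B) = F' (uni B \<boxtimes> uni B)"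
    "F (uni B \<boxtimes> n) = F' (uni B \<boxtimes> n)" "F (n \<boxtimes> uni B) = F' (n \<boxtimes> uni B)" "F (n \<boxtimes> n) = F' (n \<boxtimes> n)"
  shows "F t = F' t"
proof (rule linear_map_eq_tens[OF F])
  fix x y
  have *: "F (z \<boxtimes> y) = F' (z \<boxtimes> y)"
    if "F (z \<boxtimes> uni B) = F' (z \<boxtimes> uni B)" "F (z \<boxtimes> n) = F' (z \<boxtimes> n)" for z
    by (rule linear_map_eq_basis[of "\<lambda>y. F (z \<boxtimes> y)" "\<lambda>y. F' (z \<boxtimes> y)"])
       (use that in \<open>intro linear_rules linear_comp[OF F(1)] linear_comp[OF F(2)] | simp\<close>)+
  show "F (x \<boxtimes> y) = F' (x \<boxtimes> y)"
    by (rule linear_map_eq_basis[of "\<lambda>x. F (x \<boxtimes> y)" "\<lambda>x. F' (x \<boxtimes> y)"])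
       (use assms * in \<open>intro linear_rules linear_comp[OF F(1)] linear_comp[OF F(2)] | simp\<close>)+
qed

text \<open>
  All structure maps are linear, so it suffices to match them on the basis \<open>1, n\<close>. The forms \<open>\<alpha>\<close> and
  \<open>\<beta>\<close> are the coordinates of the target with respect to \<open>1, n'\<close>; they witness bijectivity.
\<close>

lemma isomorphic_by_basis:
  fixes A :: "('k, 'g, 'i::finite) yd_hopf"
  assumes linA: "\<And>h. linear_map (act A h)" "linear_map (coact A)" "linear_map (mul A)"
      "linear_map (comul A)" "linear_form (coun A)" "linear_map (antip A)"
    and basis: "linear_form \<alpha>" "linear_form \<beta>" "\<alpha> (uni A) = 1" "\<alpha> n' = 0" "\<beta> (uni A) = 0" "\<beta> n' = 1"
      "\<And>y. y = \<alpha> y *s uni A + \<beta> y *s n'"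
    and act: "\<And>h. act A h (uni A) = lin (ch 0) h *s uni A" "\<And>h. act A h n' = lin (ch f) h *s n'"
    and coact: "coact A (uni A) = hone H \<boxtimes> uni A" "coact A n' = v \<boxtimes> n'"
    and mul: "mul A (uni A \<boxtimes> uni A) = uni A" "mul A (uni A \<boxtimes> n') = n'" "mul A (n' \<boxtimes> uni A) = n'"
      "mul A (n' \<boxtimes> n') = lam *s n'"
    and comul: "comul A (uni A) = uni A \<boxtimes> uni A"
      "comul A n' = n' \<boxtimes> uni A + uni A \<boxtimes> n' + mu *s (n' \<boxtimes> n')"
    and coun: "coun A (uni A) = 1" "coun A n' = 0"
    and antip: "antip A (uni A) = uni A" "antip A n' = s *s n'" "antip B n = s *s n"
  shows "yd_hopf_isomorphic B A"
proof -
  define F where "F x = coun B x *s uni A + d x *s n'" for x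
  have F_lin: "linear_map F" unfolding F_def
    by (intro linear_rules coun_linear d_linear)
  have F_uni: "F (uni B) = uni A" and F_n: "F n = n'"
    by (simp_all add: F_def form_simps)
  have F_scale: "F (r *s x) = r *s F x" and F_add: "F (x + y) = F x + F y" for r x y
    using F_lin by (simp_all add: linear_map_iff)
  have \<alpha>F: "\<alpha> (F x) = coun B x" and \<beta>F: "\<beta> (F x) = d x" for x
    using basis(1-6) by (simp_all add: F_def linear_form_iff)
  have "bij F"
  proof (rule bijI)
    show "inj F" by (rule injI) (metis \<alpha>F \<beta>F split)
    show "surj F"
    proof (rule surjI)
      fix y show "F (\<alpha> y *s uni B + \<beta> y *s n) = y"
        using basis(7)[of y] by (simp add: F_scale F_add F_uni F_n)
    qed
  qed
  moreover have "yd_hom B A F" unfolding yd_hom_def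
  proof (intro conjI allI F_lin)
    fix h x
    show "F (act B h x) = act A h (F x)"
      by (rule linear_map_eq_basis)
         (use weight_uni act_n_f act in
           \<open>auto simp: weight_vector_def F_scale F_uni F_n intro!: linear_comp[OF F_lin act_linear(1)]
              linear_comp[OF linA(1) F_lin]\<close>)
    have sw: "sweedler2 (u \<boxtimes> y) (\<lambda>u y. u \<boxtimes> F y) = u \<boxtimes> F y" for u :: "'k ^ 'g" and y
      by (rule sweedler2_tens) (intro linear_rules linear_comp[OF F_lin])+
    show "coact A (F x) = sweedler2 (coact B x) (\<lambda>u y. u \<boxtimes> F y)"
      by (rule linear_map_eq_basis)
         (auto simp: sw coact_uni coact_n F_uni F_n coact intro!: linear_rules
            linear_comp[OF linA(2) F_lin] coact_linear)
  qed
  moreover have "F (mul B t) = mul A (tens_map F F t)" for t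
    by (rule linear_map_eq_basis2)
       (auto simp: tens_map_tens F_lin F_uni F_n mul mul_uni mul_nn F_scale
          intro!: linear_comp[OF F_lin mul_linear] linear_comp[OF linA(3) linear_tens_map])
  moreover have "comul A (F x) = tens_map F F (comul B x)" for x
    by (rule linear_map_eq_basis)
       (auto simp: tens_map_tens tens_map_add tens_map_scale F_lin F_uni F_n comul comul_uni comul_n
          intro!: linear_comp[OF linA(4) F_lin] linear_comp[OF linear_tens_map comul_linear])
  moreover have "coun A (F x) = coun B x" for x
    using linA(5) coun by (simp add: F_def linear_form_iff)
  moreover have "F (antip B x) = antip A (F x)" for x
    by (rule linear_map_eq_basis)
       (auto simp: antip_uni antip F_uni F_n F_scale
          intro!: linear_comp[OF F_lin antip_linear] linear_comp[OF linA(6) F_lin])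
  ultimately show ?thesis unfolding yd_hopf_isomorphic_def using F_uni by blast
qed

text \<open>
  Now \<open>B\<close> is an ordinary Hopf algebra. The coefficient identity becomes
  \<open>(lam mu + 1)(lam mu + 2) = 0\<close>; the first factor cannot vanish, since then \<open>1 + mu n\<close> would be
  a non-invertible group-like element, contradicting the antipode equation for \<open>n\<close>. With
  \<open>lam mu = -2\<close> the group-like element \<open>1 + mu n\<close> has square \<open>1\<close> and plays the generator of \<open>C\<^sub>2\<close>.
\<close>

lemma group_algebra_case:
  assumes "lam \<noteq> 0" and two: "(2 :: 'k) \<noteq> 0"
  shows "yd_hopf_isomorphic B (kC2 H)"
proof -
  have f: "f = 0" by (rule lam_f) fact
  obtain s where s: "antip B n = s *s n" "s + 1 + s * (lam * mu) = 0" by (rule antip_n)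
  have "lam * mu = 2 + 4 * (lam * mu) + (lam * mu) * (lam * mu)"
    using compat_nn f V_0 by (simp add: mult_ac)
  then have "(lam * mu + 1) * (lam * mu + 2) = 0" by (simp add: algebra_simps)
  moreover have "lam * mu + 1 \<noteq> 0"
  proof
    assume "lam * mu + 1 = 0"
    then have "lam * mu = - 1" by (simp add: eq_neg_iff_add_eq_0)
    with s(2) show False by simp
  qed
  ultimately have lm: "lam * mu = - 2" by (simp add: eq_neg_iff_add_eq_0)
  then have mu: "mu \<noteq> 0" using two by auto
  have s1: "s = 1" using s(2) unfolding lm by (simp add: algebra_simps)
  \<comment> \<open>In terms of the target, \<open>n'\<close> solves \<open>1 + mu n' = \<close> generator of \<open>C\<^sub>2\<close>.\<close>
  define n' :: "'k ^ 2" where "n' = inverse mu *s (axis 1 1 - axis 0 1)"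
  let ?A = "kC2 H :: ('k, 'g, 2) yd_hopf"
  have uni: "uni ?A = axis 0 1" by (simp add: kC2_def one_C2)
  have mul_eq: "mul ?A t = sweedler2 t (ga_mul C2)" for t by (simp add: kC2_def)
  have gm: "ga_mul C2 (x + y) z = ga_mul C2 x z + ga_mul C2 y z"
    "ga_mul C2 z (x + y) = ga_mul C2 z x + ga_mul C2 z y"
    "ga_mul C2 (x - y) z = ga_mul C2 x z - ga_mul C2 y z"
    "ga_mul C2 z (x - y) = ga_mul C2 z x - ga_mul C2 z y"
    "ga_mul C2 (r *s x) z = r *s ga_mul C2 x z"
    "ga_mul C2 z (r *s x) = r *s ga_mul C2 z x" for x y z :: "'k ^ 2" and r
    by (simp_all add: ga_mul_def algebra_simps sum.distrib scale_sum sum_subtractf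
      vec.scale_left_distrib vec.scale_left_diff_distrib)
  have mul_tens: "mul ?A (x \<boxtimes> y) = ga_mul C2 x y" for x y
    unfolding mul_eq by (rule sweedler2_tens) (simp_all add: linear_map_iff gm)
  have axes: "ga_mul C2 (axis a 1) (axis b 1) = (axis (a + b) 1 :: 'k ^ 2)" for a b
    by (simp add: ga_mul_axis mult_C2)
  have ll: "lam = - 2 * inverse mu" using lm mu by (simp add: field_simps)
  show ?thesis
  proof (rule isomorphic_by_basis[where n' = n' and \<alpha> = "\<lambda>x. x $ 0 + x $ 1" and \<beta> = "\<lambda>x. mu * x $ 1" and s = s])
    show "linear_map (act ?A h)" for h
      by (simp add: kC2_def linear_map_iff vec.scale_right_distrib mult_ac)
    show "linear_map (coact ?A)" by (simp add: kC2_def linear_map_iff tens_simps)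
    show "linear_map (mul ?A)" unfolding mul_eq[abs_def] by (intro linear_rules)
    show "linear_map (comul ?A)" using linear_ga_comul by (simp add: kC2_def)
    show "linear_form (coun ?A)"
      by (simp add: kC2_def linear_form_iff ga_counit_def sum.distrib sum_distrib_left)
    show "linear_map (antip ?A)" by (simp add: kC2_def linear_map_iff ga_antipode_C2)
    show "linear_form (\<lambda>x :: 'k ^ 2. x $ 0 + x $ 1)" "linear_form (\<lambda>x :: 'k ^ 2. mu * x $ 1)"
      by (simp_all add: linear_form_iff algebra_simps)
    show "uni ?A $ 0 + uni ?A $ 1 = 1" "n' $ 0 + n' $ 1 = 0" "mu * uni ?A $ 1 = 0" "mu * n' $ 1 = 1"
      using mu by (simp_all add: uni n'_def axis_def)
    show "y = (y $ 0 + y $ 1) *s uni ?A + (mu * y $ 1) *s n'" for y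
      unfolding vec_eq_iff
    proof
      fix i show "y $ i = ((y $ 0 + y $ 1) *s uni ?A + (mu * y $ 1) *s n') $ i"
        using two_cases[of i] mu by (auto simp: uni n'_def axis_def)
    qed
    show "act ?A h (uni ?A) = lin (ch 0) h *s uni ?A" "act ?A h n' = lin (ch f) h *s n'" for h
      by (simp_all add: kC2_def f H_simps)
    show "coact ?A (uni ?A) = hone H \<boxtimes> uni ?A" "coact ?A n' = v \<boxtimes> n'"
      using v_trivial[OF assms(1)] by (simp_all add: kC2_def)
    show "mul ?A (uni ?A \<boxtimes> uni ?A) = uni ?A" "mul ?A (uni ?A \<boxtimes> n') = n'" "mul ?A (n' \<boxtimes> uni ?A) = n'"
      by (simp_all add: mul_tens uni n'_def gm axes)
    have "mul ?A (n' \<boxtimes> n') = (inverse mu * inverse mu) *s ((- 2) *s (axis 1 1 - axis 0 1))"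
      by (simp add: mul_tens uni n'_def gm axes two_eq_zero_mod_2)
         (simp add: vec_eq_iff algebra_simps)
    then show "mul ?A (n' \<boxtimes> n') = lam *s n'" by (simp add: ll n'_def mult_ac)
    show "comul ?A (uni ?A) = uni ?A \<boxtimes> uni ?A" by (simp add: uni kC2_def ga_comul_axis)
    have gc: "ga_comul (x - y) = ga_comul x - ga_comul y" "ga_comul (r *s x) = r *s ga_comul x"
      for x y :: "'k ^ 2" and r
      by (simp_all add: ga_comul_def sum_subtractf scale_sum vec.scale_left_diff_distrib)
    have tens_diff: "(x - y) \<boxtimes> z = x \<boxtimes> z - y \<boxtimes> z" "z \<boxtimes> (x - y) = z \<boxtimes> x - z \<boxtimes> y"
      for x y z :: "'k ^ 2" by (simp_all add: vec_eq_iff tens_def algebra_simps)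
    show "comul ?A n' = n' \<boxtimes> uni ?A + uni ?A \<boxtimes> n' + mu *s (n' \<boxtimes> n')"
      using mu
      by (simp add: uni kC2_def one_C2 n'_def gc ga_comul_axis tens_simps tens_diff)
         (simp add: vec_eq_iff algebra_simps)
    show "coun ?A (uni ?A) = 1" "coun ?A n' = 0"
      by (simp_all add: uni kC2_def n'_def ga_counit_def axis_def sum_subtractf
          flip: sum_distrib_left)
    show "antip ?A (uni ?A) = uni ?A" "antip ?A n' = s *s n'" "antip B n = s *s n"
      by (simp_all add: kC2_def ga_antipode_C2 s1 s(1))
  qed
qed

text \<open>
  If \<open>n\<^sup>2 = 0\<close>, the coefficient identity is \<open>1 + \<sigma>(v) = 0\<close>. A non-zero \<open>mu\<close> would make the weight
  trivial and hence \<open>\<sigma>(v) = \<epsilon>(v) = 1\<close>, which differs from \<open>-1\<close>. So \<open>n\<close> is primitive and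
  the antipode negates it.
\<close>

lemma Bsv_case:
  assumes "lam = 0" and two: "(2 :: 'k) \<noteq> 0"
  shows "V f = - 1" "yd_hopf_isomorphic B (Bsv H (lin (ch f)) v)"
proof -
  show Vf: "V f = - 1"
    using compat_nn assms(1) by (simp add: eq_neg_iff_add_eq_0 add.commute split: if_splits)
  have mu: "mu = 0"
  proof (rule ccontr)
    assume "mu \<noteq> 0"
    then have "f = 0" by (rule mu_f)
    with Vf V_0 have "(1 :: 'k) = - 1" by simp
    then have "(1 :: 'k) + 1 = 0" by (simp add: eq_neg_iff_add_eq_0)
    with two show False by simp
  qed
  obtain s where s: "antip B n = s *s n" "s + 1 + s * (lam * mu) = 0" by (rule antip_n)
  have s1: "s = - 1" using s(2) mu by (simp add: eq_neg_iff_add_eq_0)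
  let ?A = "Bsv H (lin (ch f)) v"
  have ext: "y = y $ 0 *s (axis 0 1 :: 'k ^ 2) + y $ 1 *s axis 1 1" for y
    unfolding vec_eq_iff
  proof
    fix i show "y $ i = (y $ 0 *s (axis 0 1 :: 'k ^ 2) + y $ 1 *s axis 1 1) $ i"
      using two_cases[of i] by (auto simp: axis_def)
  qed
  show "yd_hopf_isomorphic B ?A"
  proof (rule isomorphic_by_basis[where n' = "axis 1 1" and \<alpha> = "\<lambda>x. x $ 0" and \<beta> = "\<lambda>x. x $ 1" and s = s])
    show "y = y $ 0 *s uni ?A + y $ 1 *s axis 1 1" for y
      using ext by (simp add: Bsv_def)
  qed (simp_all add: Bsv_def linear_map_iff linear_form_iff assms(1) mu s1 s(1) H_simps
      vec.scale_left_distrib vec.scale_right_distrib vec.scale_right_diff_distrib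
      vec.scale_left_diff_distrib algebra_simps tens_axis,
      simp_all add: axis_def tens_def)
qed

end

section \<open>Parity\<close>

text \<open>
  Since \<open>k\<close> is odd, \<open>m\<close> is even, so that \<open>4\<close> divides the right-hand side and \<open>c f\<^sup>2\<close> is even. If \<open>c\<close> were
  odd, \<open>f\<close> would be even, and the same equation would hold for \<open>m/2\<close> and \<open>f/2\<close>: an infinite descent.
\<close>

lemma square_times_odd_parity:
  fixes m l f c k :: nat
  assumes "m > 0" "2 * (m * l * f + c * f ^ 2) = m ^ 2 * k" "odd k"
  shows "even m" "even c"
proof -
  have even_m: "even m" if "2 * (m * l * f + c * f ^ 2) = m ^ 2 * k" for m l f :: nat
  proof -
    have "even (m ^ 2 * k)" unfolding that[symmetric] by simp
    then show ?thesis using assms(3) by simp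
  qed
  show "even m" by (rule even_m) fact
  show "even c"
    using assms(1,2)
  proof (induction m arbitrary: f rule: less_induct)
    case (less m)
    obtain m' where m: "m = 2 * m'" using even_m[OF less.prems(2)] by (auto elim: evenE)
    have eq: "2 * m' * l * f + c * f ^ 2 = 2 * m' ^ 2 * k"
      using less.prems(2) by (simp add: m power2_eq_square)
    show ?case
    proof (cases "even f")
      case False
      have "even (2 * m' * l * f + c * f ^ 2)" unfolding eq by simp
      then show ?thesis using False by simp
    next
      case True
      then obtain f' where f: "f = 2 * f'" by (auto elim: evenE)
      have "2 * (m' * l * f' + c * f' ^ 2) = m' ^ 2 * k"
        using eq by (simp add: f power2_eq_square algebra_simps)
      then show ?thesis using less.IH[of m' f'] less.prems(1) m by simp
    qed
  qed
qed

lemma field_two_nonzero: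
  assumes "CHAR('k::field) \<noteq> 2" shows "(2 :: 'k) \<noteq> 0"
proof
  assume "(2 :: 'k) = 0"
  then have "of_nat 2 = (0 :: 'k)" by simp
  then have "CHAR('k) dvd 2" by (simp only: of_nat_eq_0_iff_char_dvd)
  then have "CHAR('k) = 1" using assms
    by (metis One_nat_def prime_nat_iff two_is_prime_nat)
  then show False using of_nat_CHAR[where 'a = 'k] by simp
qed

section \<open>The parameters of the classification\<close>

context two_dim_yd_hopf
begin

text \<open>
  An \<open>m\<close>-th root of \<open>q\<^bsup>c f\<^esup>\<close> is \<open>qq\<^bsup>c f\<^esup>\<close> times a power of \<open>q\<close>, which gives the second parameter \<open>l\<close>.
  The equation \<open>V f = -1\<close> then says that \<open>qq\<close> to the power \<open>N = m l f + c f\<^sup>2\<close> is \<open>-1\<close>, i.e. that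
  \<open>2 N\<close> is an odd multiple of \<open>m\<^sup>2\<close>. Dividing by \<open>2 m\<^sup>2\<close> yields the integrality condition.
\<close>

lemma parameters:
  assumes "lam = 0" and two: "(2 :: 'k) \<noteq> 0"
  obtains l where "l < m" "\<And>j. j < m \<Longrightarrow> V j = qq ^ (m * l * j + c * f * j)"
    "even m" "even c"
    "real (l * f) / real m + real (c * f ^ 2) / real (m ^ 2) - 1 / 2 \<in> \<int>"
proof -
  have "(V 1 / qq ^ (c * f)) ^ m = 1"
    using V_1_power_m qq_nz by (simp add: power_divide q_def mult_ac flip: power_mult)
  then obtain l where l: "l < m" "V 1 / qq ^ (c * f) = q ^ l"
    using root_of_unity_is_power[OF q_prim] by blast
  then have V1: "V 1 = qq ^ (m * l + c * f)"
    using qq_nz by (simp add: field_simps q_def power_add flip: power_mult)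
  have Vj: "V j = qq ^ (m * l * j + c * f * j)" if "j < m" for j
    using V_power[OF that] unfolding V1 by (simp add: algebra_simps flip: power_mult)
  define N where "N = m * l * f + c * f ^ 2"
  have qN: "qq ^ N = - 1"
    using Bsv_case(1)[OF assms] Vj[OF f_less] by (simp add: N_def power2_eq_square mult_ac)
  have "qq ^ (2 * N) = 1" using qN by (simp add: mult.commute[of 2] power_mult)
  then have "m ^ 2 dvd 2 * N" using primitive_root_power_eq_1_iff[OF prim] by blast
  then obtain k where k: "2 * N = m ^ 2 * k" by (auto simp: dvd_def)
  have "odd k"
  proof
    assume "even k"
    then obtain k' where "k = 2 * k'" by (auto elim: evenE)
    then have "N = m ^ 2 * k'" using k by simp
    then have "qq ^ N = 1" using primitive_root_power_eq_1_iff[OF prim] by simp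
    then have "(1 :: 'k) + 1 = 0" using qN by (simp add: eq_neg_iff_add_eq_0)
    with two show False by simp
  qed
  moreover from this have par: "even m" "even c"
    using square_times_odd_parity[of m l f c k] k m2 by (auto simp: N_def)
  ultimately obtain j where j: "k = 2 * j + 1" by (auto elim: oddE)
  have "real (l * f) / real m + real (c * f ^ 2) / real (m ^ 2) = real N / real (m ^ 2)"
    using m2 by (simp add: N_def field_simps power2_eq_square)
  also have "real N / real (m ^ 2) = real k / 2"
  proof -
    have "2 * real N = real (m ^ 2) * real k" using arg_cong[OF k, of real] by simp
    then show ?thesis using m2 by (simp add: field_simps)
  qed
  also have "\<dots> - 1 / 2 = of_nat j" by (simp add: j field_simps)
  finally have "real (l * f) / real m + real (c * f ^ 2) / real (m ^ 2) - 1 / 2 \<in> \<int>" by simp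
  with l(1) Vj par show thesis by (rule that)
qed

lemma v_expansion: "v = (\<Sum>j = 0..m - 1. V j *s idem G g q j)"
proof -
  have "{0..m - 1} = {..<m}" using m2 by auto
  then show ?thesis using fourier_expansion[of v] by (simp add: V_def)
qed

lemma classification:
  assumes nontriv: "\<not> yd_hopf_isomorphic B (kC2 H)" and two: "(2 :: 'k) \<noteq> 0"
  shows "even (gcd c m)"
    "\<exists>f lam :: nat. \<exists>\<sigma> v.
       f \<in> {0..m - 1} \<and> lam \<in> {0..m - 1} \<and>
       real (lam * f) / real m + real (c * f ^ 2) / real (m ^ 2) - 1 / 2 \<in> \<int> \<and>
       algebra_hom_to_field (kPhi G g q c) \<sigma> \<and>
       (\<forall>j::nat. \<sigma> (axis (g [^]\<^bsub>G\<^esub> j) 1) = q ^ (f * j)) \<and>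
       v = (\<Sum>j = 0..m - 1. qq ^ (m * lam * j + c * f * j) *s idem G g q j) \<and>
       yd_hopf_isomorphic B (Bsv (kPhi G g q c) \<sigma> v)"
proof -
  have lam: "lam = 0" using group_algebra_case two nontriv by blast
  obtain l where l: "l < m" "\<And>j. j < m \<Longrightarrow> V j = qq ^ (m * l * j + c * f * j)"
    "even m" "even c"
    "real (l * f) / real m + real (c * f ^ 2) / real (m ^ 2) - 1 / 2 \<in> \<int>"
    using parameters[OF lam two] by blast
  show "even (gcd c m)" using l(3,4) by simp
  have "algebra_hom_to_field H (lin (ch f))"
    unfolding algebra_hom_to_field_def
    using linear_form_lin lin_ch_one lin_character_mul[OF character_ch] by (simp add: H_simps)
  moreover have "lin (ch f) (axis (pw j) 1) = q ^ (f * j)" for j by (simp add: lin_axis ch_pw)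
  moreover have "v = (\<Sum>j = 0..m - 1. qq ^ (m * l * j + c * f * j) *s idem G g q j)"
    using l(2) m2 by (subst v_expansion) (intro sum.cong, auto)
  moreover have "f \<in> {0..m - 1}" "l \<in> {0..m - 1}" using f_less l(1) by auto
  ultimately show "\<exists>f lam :: nat. \<exists>\<sigma> v.
       f \<in> {0..m - 1} \<and> lam \<in> {0..m - 1} \<and>
       real (lam * f) / real m + real (c * f ^ 2) / real (m ^ 2) - 1 / 2 \<in> \<int> \<and>
       algebra_hom_to_field (kPhi G g q c) \<sigma> \<and>
       (\<forall>j::nat. \<sigma> (axis (g [^]\<^bsub>G\<^esub> j) 1) = q ^ (f * j)) \<and>
       v = (\<Sum>j = 0..m - 1. qq ^ (m * lam * j + c * f * j) *s idem G g q j) \<and>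
       yd_hopf_isomorphic B (Bsv (kPhi G g q c) \<sigma> v)"
    using l(5) Bsv_case(2)[OF lam two] by blast
qed

end

theorem proposition4p13:
  fixes G :: "'g::finite monoid" and g :: 'g and m c :: nat and qq q :: "'k::field"
  assumes "group G" "carrier G = UNIV" "order G = m" "m \<ge> 2" "generate G {g} = carrier G"
    and "CHAR('k) \<noteq> 2"
    and "primitive_root_of_unity (m ^ 2) qq" "q = qq ^ m"
    and "c \<le> m - 1"
    and dim_two: "CARD('b::finite) = 2"
  shows "((\<exists>B :: ('k, 'g, 'b) yd_hopf. nontrivial_yd_hopf_algebra (kPhi G g q c) B)
            \<longrightarrow> even (gcd c m)) \<and>
         (even (gcd c m) \<longrightarrow>
           (\<forall>B :: ('k, 'g, 'b) yd_hopf. nontrivial_yd_hopf_algebra (kPhi G g q c) B \<longrightarrow>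
             (\<exists>f lam :: nat. \<exists>\<sigma> v.
               f \<in> {0..m - 1} \<and> lam \<in> {0..m - 1} \<and>
               real (lam * f) / real m + real (c * f ^ 2) / real (m ^ 2) - 1 / 2 \<in> \<int> \<and>
               algebra_hom_to_field (kPhi G g q c) \<sigma> \<and>
               (\<forall>j::nat. \<sigma> (axis (g [^]\<^bsub>G\<^esub> j) 1) = q ^ (f * j)) \<and>
               v = (\<Sum>j = 0..m - 1. qq ^ (m * lam * j + c * f * j) *s idem G g q j) \<and>
               yd_hopf_isomorphic B (Bsv (kPhi G g q c) \<sigma> v))))"
proof -
  interpret cyclic_reassociator G g m c qq q
    by (rule cyclic_reassociator.intro) (fact assms)+
  have main: "\<exists>n d. two_dim_yd_hopf G g m c qq q B n d \<and> \<not> yd_hopf_isomorphic B (kC2 H)"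
    if B: "nontrivial_yd_hopf_algebra H B" for B :: "('k, 'g, 'b) yd_hopf"
  proof -
    have hopf: "yd_hopf_algebra H B" using B by (simp add: nontrivial_yd_hopf_algebra_def)
    have unit: "coun B (uni B) = 1" and hom: "yd_hom B (yd_unit H) (\<lambda>b. vec (coun B b))"
      using hopf by (auto simp: yd_hopf_algebra_def)
    from hom have lin: "linear_form (coun B)"
      by (auto simp: yd_hom_def linear_map_iff linear_form_iff vec_eq_iff)
    obtain n d where "linear_form d" "coun B n = 0" "d n = 1" "d (uni B) = 0"
      "\<And>x. x = coun B x *s uni B + d x *s n"
      using two_dim_split[OF dim_two lin unit] by metis
    then have "two_dim_yd_hopf G g m c qq q B n d"
      by (intro two_dim_yd_hopf.intro two_dim_yd_hopf_axioms.intro cyclic_reassociator_axioms hopf)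
    then show ?thesis using B by (auto simp: nontrivial_yd_hopf_algebra_def)
  qed
  show ?thesis
  proof (intro conjI impI allI, elim exE)
    fix B :: "('k, 'g, 'b) yd_hopf"
    assume "nontrivial_yd_hopf_algebra H B"
    from main[OF this] show "even (gcd c m)"
      using two_dim_yd_hopf.classification(1) field_two_nonzero[OF assms(6)] by blast
  next
    fix B :: "('k, 'g, 'b) yd_hopf"
    assume "nontrivial_yd_hopf_algebra H B"
    from main[OF this] obtain n d where B: "two_dim_yd_hopf G g m c qq q B n d"
      "\<not> yd_hopf_isomorphic B (kC2 H)" by blast
    show "\<exists>f lam :: nat. \<exists>\<sigma> v.
               f \<in> {0..m - 1} \<and> lam \<in> {0..m - 1} \<and>
               real (lam * f) / real m + real (c * f ^ 2) / real (m ^ 2) - 1 / 2 \<in> \<int> \<and>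
               algebra_hom_to_field (kPhi G g q c) \<sigma> \<and>
               (\<forall>j::nat. \<sigma> (axis (g [^]\<^bsub>G\<^esub> j) 1) = q ^ (f * j)) \<and>
               v = (\<Sum>j = 0..m - 1. qq ^ (m * lam * j + c * f * j) *s idem G g q j) \<and>
               yd_hopf_isomorphic B (Bsv (kPhi G g q c) \<sigma> v)"
      by (rule two_dim_yd_hopf.classification(2)[OF B field_two_nonzero[OF assms(6)]])
  qed
qed

end
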